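(* Let $Q_0 = [0,1] \subset \mathbb{R}$ and let $1 < p < \infty$. Then there exists a nonnegative function $f$ on $Q_0$ such that $f^{1/q} \notin JN_q(Q_0)$ whenever $1 < q \leq p$, and $f^{1/q} \in JN_q(Q_0)$ for every $q \in (p,\infty)$.
   Context: For an integrable function $h$ on an interval $J$ write $h_J := \frac{1}{|J|}\int_J h$. For a bounded interval $Q_0 \subset \mathbb{R}$ and $1<q<\infty$, a function $h$ belongs to $JN_q(Q_0)$ if $h \in L^1(Q_0)$ and there is a constant $K<\infty$ such that $\sum_{i=1}^\infty |Q_i| \left( \frac{1}{|Q_i|}\int_{Q_i} |h - h_{Q_i}| \right)^q \leq K^q$ for all countable collections of pairwise disjoint intervals $(Q_i)_{i=1}^\infty$ contained in $Q_0$. *)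

theory Defs
  imports "HOL-Analysis.Analysis"
begin

definition avg :: "real set \<Rightarrow> (real \<Rightarrow> real) \<Rightarrow> real" where
  "avg J h = (1 / measure lebesgue J) * (LINT x:J|lebesgue. h x)"

(* Intervals may be open, closed or half-open. Empty and one-point intervals are admitted:
   their term carries the factor |Q i| = 0 and vanishes, so finite collections are covered by
   padding with empty sets. The series is taken in ennreal because over the reals suminf is
   unspecified for divergent series. *)
definition JN :: "real \<Rightarrow> real set \<Rightarrow> (real \<Rightarrow> real) set" where
  "JN q Q0 = {h. set_integrable lebesgue Q0 h \<and>
     (\<exists>K::real. 0 \<le> K \<and>
       (\<forall>Q :: nat \<Rightarrow> real set.
          (\<forall>i. is_interval (Q i) \<and> Q i \<subseteq> Q0) \<and> disjoint_family Q \<longrightarrow>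
          (\<Sum>i. ennreal (measure lebesgue (Q i) *
                  (avg (Q i) (\<lambda>x. \<bar>h x - avg (Q i) h\<bar>)) powr q))
            \<le> ennreal (K powr q)))}"

end

theory Submission
  imports Defs
begin

text \<open>
  The function is built on a binary tree of intervals, called cells. The unit interval is the cell of
  level \<open>0\<close>. A cell of level \<open>m\<close> starts with a gap, whose share of the cell is about \<open>\<epsilon> m\<close>, and is then
  filled by two adjacent cells of level \<open>m + 1\<close> of equal length. On the gaps of level \<open>m\<close> the function
  \<open>f\<close> has the value \<open>height m\<close>, where \<open>height (m + 1) = (1 + \<epsilon> m) * height m\<close>. The lengths are chosen so that
  the cells of level \<open>m\<close> together have measure \<open>1 / height m\<close>; equivalently, giving mass \<open>2\<^sup>-\<^sup>m\<close> to each
  cell of level \<open>m\<close> means giving it mass \<open>height m\<close> times its length.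

  Put \<open>g = f powr (1 / q)\<close> and consider the contribution \<open>|Q| (avg |g - avg g|)\<^sup>q\<close> of an interval \<open>Q\<close>. Let \<open>m\<close>
  be the level of the smallest cell containing \<open>Q\<close>. Two things can make \<open>g\<close> oscillate on \<open>Q\<close>.

  First, \<open>Q\<close> may contain deeper cells, on which \<open>g\<close> is large. Over one cell of level \<open>j\<close> the average of \<open>g\<close> is
  at most \<open>q / (q - 1)\<close> times its smallest value \<open>height j powr (1 / q)\<close>, so by Hoelder's inequality these
  cells contribute at most a constant times the mass of \<open>Q\<close>. Disjoint intervals have total mass at
  most \<open>1\<close>, for every \<open>q > 1\<close>.

  Secondly, \<open>Q\<close> may contain the left end of a child cell, next to which there is a gap on which \<open>g\<close> exceeds
  its value on the parent's gap by about \<open>\<epsilon> m\<close> times that value. This matters on the scale of the gap only, since longer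
  intervals pick up mass. The contribution is therefore about \<open>(\<epsilon> m)\<^sup>q\<close> times \<open>height m\<close> times the length of the gap, that is
  \<open>(\<epsilon> m) powr (q + 1)\<close> times the mass of the parent cell. A point lies in at most one of several
  disjoint intervals, so all jumps together contribute a constant times the sum of
  \<open>\<epsilon> m powr (q + 1)\<close> over \<open>m\<close>. Conversely, the intervals of about the length of a gap that are
  centred at the ends of the gaps are disjoint and realise this sum up to a constant.

  Hence \<open>f powr (1 / q)\<close> belongs to \<open>JN q\<close> if and only if \<open>\<epsilon> m powr (q + 1)\<close> is summable
  (\<open>profile_in_JN\<close> and \<open>summable_if_profile_in_JN\<close>), and for \<open>\<epsilon> m\<close> proportional to
  \<open>(m + 1) powr (- 1 / (p + 1))\<close> this says \<open>p < q\<close>.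

  Both kinds of contribution are recorded by one increasing function, \<open>charge\<close>: its increment over \<open>Q\<close> is
  the mass of \<open>Q\<close> together with an atom for each left end of a child cell in \<open>Q\<close>. The bound
  \<open>oscillation_le_charge\<close> is then local to a single interval, and summation over disjoint
  intervals is only the monotonicity of \<open>charge\<close>.
\<close>

section \<open>Averages and disjoint families of intervals\<close>

text \<open>
  The end points form a null set, so every interval may be replaced by a half-open one.
\<close>
lemma avg_sandwich:
  assumes "{u<..<v} \<subseteq> Q" "Q \<subseteq> {u..v}"
  shows "avg Q h = avg {u..<v} h" "measure lebesgue Q = measure lebesgue {u..<v::real}"
proof -
  have X: "(Q - {u..<v}) \<union> ({u..<v} - Q) \<subseteq> {u, v}" using assms by force
  have eq: "set_lebesgue_integral lebesgue Q g = set_lebesgue_integral lebesgue {u..<v} g" for g :: "real \<Rightarrow> real"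
    using X by (intro set_integral_discrete_difference[where X = "{u, v}"]) auto
  show M: "measure lebesgue Q = measure lebesgue {u..<v}"
    using eq[of "\<lambda>x. 1"] by (simp add: set_lebesgue_integral_def)
  show "avg Q h = avg {u..<v} h" using eq[of h] M by (simp add: avg_def)
qed

lemma interval_endpoints:
  fixes Q :: "real set"
  assumes "is_interval Q" "Q \<subseteq> {a..b}" "a \<le> b"
  obtains u v where "a \<le> u" "u \<le> v" "v \<le> b" "{u<..<v} \<subseteq> Q" "Q \<subseteq> {u..v}"
proof (cases "Q = {}")
  case True
  then show ?thesis using that[of a a] assms by simp
next
  case False
  have bdd: "bdd_below Q" "bdd_above Q"
    using bdd_below_mono[OF bdd_below_Icc assms(2)] bdd_above_mono[OF bdd_above_Icc assms(2)] by simp_all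
  have "a \<le> Inf Q" using False assms(2) by (intro cInf_greatest) auto
  moreover have "Sup Q \<le> b" using False assms(2) by (intro cSup_least) auto
  moreover have "Inf Q \<le> Sup Q"
  proof -
    obtain x where x: "x \<in> Q" using False by blast
    have "Inf Q \<le> x" using x bdd(1) by (rule cInf_lower)
    also have "x \<le> Sup Q" using x bdd(2) by (rule cSup_upper)
    finally show ?thesis .
  qed
  moreover have "x \<in> Q" if x: "Inf Q < x" "x < Sup Q" for x
  proof -
    obtain y where y: "y \<in> Q" "y < x" using cInf_lessD[OF False x(1)] by blast
    obtain z where z: "z \<in> Q" "x < z" using less_cSupD[OF False x(2)] by blast
    show ?thesis using assms(1) y z unfolding is_interval_1 by (meson less_imp_le)
  qed
  moreover have "Q \<subseteq> {Inf Q..Sup Q}"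
  proof
    fix x assume "x \<in> Q"
    then have "Inf Q \<le> x" "x \<le> Sup Q"
      using cInf_lower[OF _ bdd(1)] cSup_upper[OF _ bdd(2)] by blast+
    then show "x \<in> {Inf Q..Sup Q}" by simp
  qed
  moreover from calculation have "{Inf Q<..<Sup Q} \<subseteq> Q" by auto
  ultimately show ?thesis using that[of "Inf Q" "Sup Q"] by blast
qed

text \<open>
  Partial sums suffice because all terms are nonnegative, and half-open intervals suffice because end points
  are null. Only the interiors can be required to be disjoint.
\<close>
lemma JN_unit_interval_I:
  fixes h :: "real \<Rightarrow> real"
  assumes q: "0 < q" and int: "set_integrable lebesgue {0..1} h"
    and bound: "\<And>(n::nat) u v. (\<And>i. i < n \<Longrightarrow> 0 \<le> u i \<and> u i \<le> v i \<and> v i \<le> 1) \<Longrightarrow>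
      (\<And>i j. i < n \<Longrightarrow> j < n \<Longrightarrow> i \<noteq> j \<Longrightarrow> {u i<..<v i} \<inter> {u j<..<v j} = {}) \<Longrightarrow>
      (\<Sum>i<n. (v i - u i) * (avg {u i..<v i} (\<lambda>x. \<bar>h x - avg {u i..<v i} h\<bar>)) powr q) \<le> B"
  shows "h \<in> JN q {0..1}"
proof -
  have B: "0 \<le> B" using bound[of 0] by simp
  have "(\<Sum>i. ennreal (measure lebesgue (Q i) * (avg (Q i) (\<lambda>x. \<bar>h x - avg (Q i) h\<bar>)) powr q))
      \<le> ennreal ((B powr (1 / q)) powr q)"
    if Q: "\<And>i. is_interval (Q i)" "\<And>i. Q i \<subseteq> {0..1}" "disjoint_family Q" for Q :: "nat \<Rightarrow> real set"
  proof -
    have "\<exists>u v. 0 \<le> u \<and> u \<le> v \<and> v \<le> 1 \<and> {u<..<v} \<subseteq> Q i \<and> Q i \<subseteq> {u..v}" for i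
      using interval_endpoints[OF Q(1)[of i] Q(2)[of i]] by (metis zero_le_one)
    then obtain u v where uv: "\<And>i. 0 \<le> u i" "\<And>i. u i \<le> v i" "\<And>i. v i \<le> 1"
      "\<And>i. {u i<..<v i} \<subseteq> Q i" "\<And>i. Q i \<subseteq> {u i..v i}" by metis
    have disj: "{u i<..<v i} \<inter> {u j<..<v j} = {}" if "i \<noteq> j" for i j
      using Q(3) uv(4)[of i] uv(4)[of j] that by (fastforce simp: disjoint_family_on_def)
    define e where "e i = (v i - u i) * (avg {u i..<v i} (\<lambda>x. \<bar>h x - avg {u i..<v i} h\<bar>)) powr q" for i
    have meas: "measure lebesgue (Q i) = v i - u i" for i
      unfolding avg_sandwich(2)[OF uv(4)[of i] uv(5)[of i]] using uv(2)[of i] by simp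
    have eq: "measure lebesgue (Q i) * (avg (Q i) (\<lambda>x. \<bar>h x - avg (Q i) h\<bar>)) powr q = e i" for i
      unfolding e_def meas avg_sandwich(1)[OF uv(4)[of i] uv(5)[of i]] ..
    have nonneg: "0 \<le> e i" for i
      unfolding e_def using uv(2)[of i] by (intro mult_nonneg_nonneg) simp_all
    have BB: "(B powr (1 / q)) powr q = B" using B q by (simp add: powr_powr)
    show ?thesis unfolding eq BB
    proof (rule suminf_le_const)
      fix n
      have "(\<Sum>i<n. e i) \<le> B"
        unfolding e_def by (rule bound) (use uv(1-3) disj in blast)+
      then show "(\<Sum>i<n. ennreal (e i)) \<le> ennreal B"
        using nonneg by (simp add: sum_ennreal ennreal_leI)
    qed simp
  qed
  then have "\<forall>Q :: nat \<Rightarrow> real set. (\<forall>i. is_interval (Q i) \<and> Q i \<subseteq> {0..1}) \<and> disjoint_family Q \<longrightarrow>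
      (\<Sum>i. ennreal (measure lebesgue (Q i) * (avg (Q i) (\<lambda>x. \<bar>h x - avg (Q i) h\<bar>)) powr q))
        \<le> ennreal ((B powr (1 / q)) powr q)"
    by blast
  moreover have "0 \<le> B powr (1 / q)" by simp
  ultimately show ?thesis unfolding JN_def using int by blast
qed

text \<open>
  With \<open>a\<close> the average of \<open>h\<close> and \<open>b\<close> a lower bound, \<open>|h - a| \<le> (h - b) + (a - b)\<close>, and both summands
  average to \<open>a - b\<close>. Thus for functions bounded below by \<open>b\<close> it is enough to know the average.
\<close>
lemma avg_deviation_le:
  fixes h :: "real \<Rightarrow> real"
  assumes int: "set_integrable lebesgue {u..<v} h" and uv: "u < v"
    and b: "AE x\<in>{u..<v} in lebesgue. b \<le> h x"
  shows "b \<le> avg {u..<v} h" "avg {u..<v} (\<lambda>x. \<bar>h x - avg {u..<v} h\<bar>) \<le> 2 * (avg {u..<v} h - b)"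
proof -
  define L where "L = v - u"
  define I where "I = (LINT x:{u..<v}|lebesgue. h x)"
  define a where "a = avg {u..<v} h"
  have L: "0 < L" "measure lebesgue {u..<v} = L" using uv by (simp_all add: L_def)
  have aI: "I = a * L" using L by (simp add: a_def avg_def I_def)
  have const: "set_integrable lebesgue {u..<v} (\<lambda>x. c)" "(LINT x:{u..<v}|lebesgue. c) = L * c" for c :: real
    using L uv by (auto simp: set_integrable_def set_lebesgue_integral_def intro!: integrable_real_indicator)
  have "L * b \<le> I" unfolding I_def const(2)[symmetric]
    by (rule set_integral_mono_AE[OF const(1) int b])
  then have ab: "b \<le> a" using L aI by (simp add: mult.commute)
  then show "b \<le> avg {u..<v} h" by (simp add: a_def)
  have "(LINT x:{u..<v}|lebesgue. \<bar>h x - a\<bar>) \<le> (LINT x:{u..<v}|lebesgue. (h x - b) + (a - b))"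
  proof (rule set_integral_mono_AE)
    show "set_integrable lebesgue {u..<v} (\<lambda>x. \<bar>h x - a\<bar>)"
      by (intro set_integrable_abs set_integral_diff int const)
    show "set_integrable lebesgue {u..<v} (\<lambda>x. (h x - b) + (a - b))"
      by (intro set_integral_add set_integral_diff int const)
    show "AE x\<in>{u..<v} in lebesgue. \<bar>h x - a\<bar> \<le> h x - b + (a - b)"
      using b ab by (auto elim!: eventually_mono)
  qed
  also have "\<dots> = (LINT x:{u..<v}|lebesgue. h x - b) + (LINT x:{u..<v}|lebesgue. a - b)"
    by (intro set_integral_add set_integral_diff int const)
  also have "(LINT x:{u..<v}|lebesgue. h x - b) = I - L * b"
    using set_integral_diff(2)[OF int const(1)[of b]] by (simp only: const(2) I_def)
  also have "I - L * b + (LINT x:{u..<v}|lebesgue. a - b) = (I - L * b) + L * (a - b)"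
    by (simp only: const(2))
  also have "\<dots> = L * (2 * (a - b))" by (simp add: aI algebra_simps)
  finally have "(LINT x:{u..<v}|lebesgue. \<bar>h x - a\<bar>) / L \<le> 2 * (a - b)"
    using L by (simp add: divide_le_eq mult.commute)
  then show "avg {u..<v} (\<lambda>x. \<bar>h x - avg {u..<v} h\<bar>) \<le> 2 * (avg {u..<v} h - b)"
    unfolding a_def[symmetric] by (simp add: avg_def L)
qed

lemma avg_two_steps:
  fixes h :: "real \<Rightarrow> real"
  assumes r: "0 < r" and h: "\<And>x. y - r \<le> x \<Longrightarrow> x < y \<Longrightarrow> h x = a" "\<And>x. y \<le> x \<Longrightarrow> x < y + r \<Longrightarrow> h x = b"
  shows "avg {y - r..<y + r} h = (a + b) / 2"
proof -
  have const: "set_integrable lebesgue {s..<t} (\<lambda>x. c)" "s \<le> t \<Longrightarrow> (LINT x:{s..<t}|lebesgue. c) = (t - s) * c"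
    for c s t :: real
    by (cases "s \<le> t"; auto simp: set_integrable_def set_lebesgue_integral_def intro!: integrable_real_indicator)+
  have 1: "set_integrable lebesgue {y - r..<y} h" "(LINT x:{y - r..<y}|lebesgue. h x) = r * a"
    using set_integrable_cong[of lebesgue lebesgue "{y - r..<y}" "{y - r..<y}" h "\<lambda>x. a"]
      set_lebesgue_integral_cong[of "{y - r..<y}" lebesgue h "\<lambda>x. a"] h(1) const[of "y - r" y a] r by auto
  have 2: "set_integrable lebesgue {y..<y + r} h" "(LINT x:{y..<y + r}|lebesgue. h x) = r * b"
    using set_integrable_cong[of lebesgue lebesgue "{y..<y + r}" "{y..<y + r}" h "\<lambda>x. b"]
      set_lebesgue_integral_cong[of "{y..<y + r}" lebesgue h "\<lambda>x. b"] h(2) const[of y "y + r" b] r by auto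
  have "{y - r..<y + r} = {y - r..<y} \<union> {y..<y + r}" using r by auto
  then have "(LINT x:{y - r..<y + r}|lebesgue. h x) = r * a + r * b"
    using set_integral_Un[OF _ 1(1) 2(1)] 1(2) 2(2) by simp
  then show ?thesis using r by (simp add: avg_def field_simps)
qed

lemma avg_deviation_two_steps:
  fixes h :: "real \<Rightarrow> real"
  assumes r: "0 < r" and h: "\<And>x. y - r \<le> x \<Longrightarrow> x < y \<Longrightarrow> h x = a" "\<And>x. y \<le> x \<Longrightarrow> x < y + r \<Longrightarrow> h x = b"
  shows "avg {y - r..<y + r} (\<lambda>x. \<bar>h x - avg {y - r..<y + r} h\<bar>) = \<bar>b - a\<bar> / 2"
proof -
  have "avg {y - r..<y + r} (\<lambda>x. \<bar>h x - (a + b) / 2\<bar>) = (\<bar>a - (a + b) / 2\<bar> + \<bar>b - (a + b) / 2\<bar>) / 2"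
    using h by (intro avg_two_steps[OF r]) auto
  moreover have "(\<bar>a - (a + b) / 2\<bar> + \<bar>b - (a + b) / 2\<bar>) / 2 = \<bar>b - a\<bar> / 2" by (simp add: abs_if field_simps)
  moreover have "avg {y - r..<y + r} h = (a + b) / 2" by (rule avg_two_steps[OF assms])
  ultimately show ?thesis by (simp only:)
qed

text \<open>
  A monotone function maps disjoint intervals to disjoint intervals; compare their total length with that
  of the image of the whole interval.
\<close>
lemma sum_increments_le:
  fixes N :: "real \<Rightarrow> real" and u v :: "nat \<Rightarrow> real"
  assumes N: "\<And>x y. a \<le> x \<Longrightarrow> x \<le> y \<Longrightarrow> y \<le> b \<Longrightarrow> N x \<le> N y" and "a \<le> b"
    and uv: "\<And>i. i < n \<Longrightarrow> a \<le> u i \<and> u i \<le> v i \<and> v i \<le> b"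
    and disj: "\<And>i j. i < n \<Longrightarrow> j < n \<Longrightarrow> i \<noteq> j \<Longrightarrow> {u i<..<v i} \<inter> {u j<..<v j} = {}"
  shows "(\<Sum>i<n. N (v i) - N (u i)) \<le> N b - N a"
proof -
  let ?S = "\<lambda>i. {N (u i)<..<N (v i)}"
  have ord: "a \<le> u i" "u i \<le> v i" "v i \<le> b" "N (u i) \<le> N (v i)" "N a \<le> N (u i)" "N (v i) \<le> N b" if "i < n" for i
  proof -
    show i: "a \<le> u i" "u i \<le> v i" "v i \<le> b" using uv[OF that] by auto
    show "N (u i) \<le> N (v i)" "N a \<le> N (u i)" "N (v i) \<le> N b"
      using N[of "u i" "v i"] N[of a "u i"] N[of "v i" b] i by linarith+
  qed
  have "disjoint_family_on ?S {..<n}"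
    unfolding disjoint_family_on_def
  proof (intro ballI impI)
    fix i j assume "i \<in> {..<n}" "j \<in> {..<n}" and neq: "i \<noteq> j"
    then have ij: "i < n" "j < n" "i \<noteq> j" by simp_all
    have "v i \<le> u j \<or> v j \<le> u i \<or> u i = v i \<or> u j = v j"
    proof (rule ccontr)
      assume "\<not> ?thesis"
      then have "max (u i) (u j) < min (v i) (v j)" using ord[OF ij(1)] ord[OF ij(2)] by linarith
      then obtain x where "max (u i) (u j) < x" "x < min (v i) (v j)" using dense by blast
      then have "x \<in> {u i<..<v i} \<inter> {u j<..<v j}" by auto
      with disj[OF ij] show False by simp
    qed
    then show "?S i \<inter> ?S j = {}"
    proof (elim disjE)
      assume "v i \<le> u j"
      with N[of "v i" "u j"] ord[OF ij(1)] ord[OF ij(2)] have "N (v i) \<le> N (u j)" by linarith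
      then show ?thesis by auto
    next
      assume "v j \<le> u i"
      with N[of "v j" "u i"] ord[OF ij(1)] ord[OF ij(2)] have "N (v j) \<le> N (u i)" by linarith
      then show ?thesis by auto
    qed simp_all
  qed
  then have "measure lborel (\<Union>i<n. ?S i) = (\<Sum>i<n. measure lborel (?S i))"
    using ord(4) by (intro measure_finite_Union) auto
  also have "\<dots> = (\<Sum>i<n. N (v i) - N (u i))"
    using ord by (intro sum.cong) auto
  finally have "(\<Sum>i<n. N (v i) - N (u i)) = measure lborel (\<Union>i<n. ?S i)" by simp
  also have "\<dots> \<le> measure lborel {N a..N b}"
  proof (rule measure_mono_fmeasurable)
    show "(\<Union>i<n. ?S i) \<subseteq> {N a..N b}"
    proof (intro UN_least subsetI)
      fix i x assume "i \<in> {..<n}" "x \<in> ?S i"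
      with ord(5,6)[of i] show "x \<in> {N a..N b}" by simp
    qed
    show "{N a..N b} \<in> fmeasurable lborel"
      using N[of a b] \<open>a \<le> b\<close> by (simp add: fmeasurable_def)
  qed auto
  also have "\<dots> = N b - N a" using N[of a b] \<open>a \<le> b\<close> by simp
  finally show ?thesis .
qed

section \<open>Power inequalities\<close>

text \<open>
  The power with exponent between \<open>0\<close> and \<open>1\<close> is concave, hence below its tangent at \<open>1\<close>.
\<close>
lemma powr_le_tangent_at_1:
  fixes t a :: real
  assumes "0 < t" "0 \<le> a" "a \<le> 1"
  shows "t powr a \<le> 1 + a * (t - 1)"
  using Youngs_inequality_0[of a "1 - a" t 1] assms by (simp add: algebra_simps)

text \<open>
  A linearised form of Hoelder's inequality. Integrated over a set it bounds the integral of a root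
  by \<open>c\<close> times the length plus \<open>c powr (1 - q)\<close> times the mass. For fixed \<open>c\<close> such bounds are additive over pieces, so the
  choice of \<open>c\<close> can be left to the very end, where \<open>c\<close> is a power of the ratio of mass and length.
\<close>
lemma root_le_mix:
  fixes c x q :: real
  assumes c: "0 < c" and x: "0 \<le> x" and q: "1 < q"
  shows "x powr (1 / q) \<le> c + c powr (1 - q) * x"
proof (cases "x powr (1 / q) \<le> c")
  case True
  then show ?thesis using x by (smt (verit) mult_nonneg_nonneg powr_ge_zero)
next
  case False
  define y where "y = x powr (1 / q)"
  have y: "c < y" "0 < y" using False c by (auto simp: y_def)
  have xy: "x = y powr q" using q x by (simp add: y_def powr_powr)
  have "y = y powr (1 - q) * y powr q" using y by (simp flip: powr_add)
  also have "\<dots> \<le> c powr (1 - q) * y powr q"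
    using y c q by (intro mult_right_mono powr_mono2') auto
  finally have "y \<le> c powr (1 - q) * x" by (simp only: xy)
  with c show ?thesis by (simp add: y_def)
qed

section \<open>Nested gaps on the unit interval\<close>

text \<open>
  The non-summability makes the heights tend to infinity, so that almost every point lies in some gap.
\<close>
locale gap_tree =
  fixes \<epsilon> :: "nat \<Rightarrow> real"
  assumes eps_pos: "0 < \<epsilon> m" and eps_le_half: "\<epsilon> m \<le> 1 / 2" and eps_Suc_le: "\<epsilon> (Suc m) \<le> \<epsilon> m"
    and eps_not_summable: "\<not> summable \<epsilon>"
begin

definition height :: "nat \<Rightarrow> real" where
  "height m = (\<Prod>j<m. 1 + \<epsilon> j)"

definition len :: "nat \<Rightarrow> real" where
  "len m = 1 / (2 ^ m * height m)"

definition gap :: "nat \<Rightarrow> real" where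
  "gap m = 2 * \<epsilon> m * len (Suc m)"

definition mid :: "nat \<Rightarrow> real" where
  "mid m = gap m + len (Suc m)"

lemma height_0 [simp]: "height 0 = 1"
  by (simp add: height_def)

lemma height_Suc: "height (Suc m) = (1 + \<epsilon> m) * height m"
  by (simp add: height_def)

lemma height_pos: "0 < height m"
  unfolding height_def using eps_pos by (intro prod_pos) (simp add: add_pos_pos)

lemma height_mono: "m \<le> n \<Longrightarrow> height m \<le> height n"
proof (induction n rule: dec_induct)
  case (step n)
  then show ?case using height_pos[of n] eps_pos[of n] by (auto simp: height_Suc algebra_simps intro: add_increasing2)
qed simp

lemma height_unbounded: "\<exists>m. B < height m"
proof (rule ccontr)
  assume "\<not> ?thesis"
  moreover have "(\<Sum>j<m. \<epsilon> j) \<le> height m" for m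
    unfolding height_def using eps_pos by (intro sum_le_prod) (simp add: less_imp_le)
  ultimately have "(\<Sum>j<m. \<epsilon> j) \<le> B" for m by (meson not_le order_trans)
  then have "summable \<epsilon>" using eps_pos by (intro summableI_nonneg_bounded) (auto simp: less_imp_le)
  with eps_not_summable show False ..
qed

lemma len_pos: "0 < len m"
  using height_pos by (simp add: len_def)

lemma len_0 [simp]: "len 0 = 1"
  by (simp add: len_def)

lemma height_len: "height m * len m = 1 / 2 ^ m"
  using height_pos[of m] by (simp add: len_def)

lemma gap_pos: "0 < gap m"
  using eps_pos len_pos by (simp add: gap_def)

lemma len_eq: "len m = 2 * (1 + \<epsilon> m) * len (Suc m)"
proof -
  have "1 + \<epsilon> m \<noteq> 0" using eps_pos[of m] by simp
  then show ?thesis using height_pos[of m] by (simp add: len_def height_Suc divide_simps)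
qed

lemma len_mid: "len m = mid m + len (Suc m)"
  using len_eq[of m] by (simp add: mid_def gap_def algebra_simps)

lemma len_Suc_le: "len (Suc m) \<le> len m / 2"
  using len_eq[of m] len_pos[of "Suc m"] eps_pos[of m] by (simp add: algebra_simps)

lemma gap_le_len_Suc: "gap m \<le> len (Suc m)"
  using eps_le_half[of m] len_pos[of "Suc m"] by (simp add: gap_def)

lemma gap_Suc_le: "gap (Suc m) \<le> gap m / 2"
proof -
  have "gap (Suc m) \<le> 2 * \<epsilon> m * (len (Suc m) / 2)"
    unfolding gap_def using eps_pos[of "Suc m"] eps_Suc_le[of m] len_Suc_le[of "Suc m"] len_pos[of "Suc (Suc m)"]
    by (intro mult_mono) auto
  then show ?thesis by (simp add: gap_def)
qed

lemma tree_order: "0 < gap m" "gap m < mid m" "mid m < len m"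
  using gap_pos len_pos[of "Suc m"] len_mid[of m] by (auto simp: mid_def)

lemma mid_minus_gap: "mid m - gap m = len (Suc m)" and len_minus_mid: "len m - mid m = len (Suc m)"
  using len_mid[of m] by (auto simp: mid_def)

text \<open>
  \<open>level d m x\<close> is the level of the gap containing the point at distance \<open>x\<close> from the left end of a cell of
  level \<open>m\<close>, where the cells \<open>d\<close> generations further down are not subdivided any more and count as
  gaps. The two child cells start at \<open>gap m\<close> and at \<open>mid m\<close>.
\<close>
primrec level :: "nat \<Rightarrow> nat \<Rightarrow> real \<Rightarrow> nat" where
  "level 0 m x = m"
| "level (Suc d) m x =
    (if x < gap m then m
     else if x < mid m then level d (Suc m) (x - gap m)
     else level d (Suc m) (x - mid m))"

text \<open>
  The integral of \<open>v (level d m t)\<close> over \<open>t\<close> from \<open>0\<close> to \<open>x\<close>, in recursive form. It turns all estimates of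
  integrals into inductions over the generations.
\<close>
primrec primitive :: "(nat \<Rightarrow> real) \<Rightarrow> nat \<Rightarrow> nat \<Rightarrow> real \<Rightarrow> real" where
  "primitive v 0 m x = v m * x"
| "primitive v (Suc d) m x =
    (if x \<le> gap m then v m * x
     else if x \<le> mid m then v m * gap m + primitive v d (Suc m) (x - gap m)
     else v m * gap m + primitive v d (Suc m) (len (Suc m)) + primitive v d (Suc m) (x - mid m))"

lemma level_ge: "m \<le> level d m x"
proof (induction d arbitrary: m x)
  case (Suc d)
  show ?case using Suc.IH[of "Suc m" "x - gap m"] Suc.IH[of "Suc m" "x - mid m"] by (auto dest: Suc_leD)
qed simp

lemma level_le: "level d m x \<le> m + d"
proof (induction d arbitrary: m x)
  case (Suc d)
  show ?case using Suc.IH[of "Suc m" "x - gap m"] Suc.IH[of "Suc m" "x - mid m"] by simp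
qed simp

lemma level_stable: "level d m x < m + d \<Longrightarrow> d \<le> d' \<Longrightarrow> level d' m x = level d m x"
proof (induction d arbitrary: m x d')
  case (Suc d)
  from Suc.prems(2) obtain e where e: "d' = Suc e" "d \<le> e" using Suc_le_D by blast
  have IH: "level e (Suc m) y = level d (Suc m) y" if "level d (Suc m) y < m + Suc d" for y
    using Suc.IH[of "Suc m" y e] e that by simp
  show ?case using Suc.prems(1) IH[of "x - gap m"] IH[of "x - mid m"] unfolding e(1) by (auto split: if_splits)
qed simp

lemma level_mono: "d \<le> d' \<Longrightarrow> level d m x \<le> level d' m x"
proof (induction d arbitrary: m x d')
  case 0
  then show ?case using level_ge by simp
next
  case (Suc d)
  from Suc.prems obtain e where e: "d' = Suc e" "d \<le> e" using Suc_le_D by blast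
  show ?case unfolding e(1) using Suc.IH[OF e(2)] by simp
qed

lemma primitive_at_0 [simp]: "primitive v d m 0 = 0"
  using tree_order(1)[of m] by (cases d) auto

lemma has_integral_level_initial:
  "0 \<le> y \<Longrightarrow> ((\<lambda>x. v (level d m x)) has_integral primitive v d m y) {0..y}"
proof (induction d arbitrary: m y)
  case 0
  then show ?case using has_integral_const_real[of "v m" 0 y] by (simp add: mult.commute)
next
  case (Suc d)
  note o = tree_order[of m]
  let ?f = "\<lambda>x. v (level (Suc d) m x)"
  \<comment> \<open>The branches of the recursion disagree with \<open>?f\<close> at most at the right end point of a piece.\<close>
  have gap: "(?f has_integral v m * t) {0..t}" if "0 \<le> t" "t \<le> gap m" for t
  proof (rule has_integral_spike_finite[where S = "{gap m}"])
    show "((\<lambda>x. v m) has_integral v m * t) {0..t}"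
      using has_integral_const_real[of "v m" 0 t] that by (simp add: mult.commute)
  qed (use that in auto)
  have left: "(?f has_integral primitive v d (Suc m) (t - gap m)) {gap m..t}"
    if "gap m \<le> t" "t \<le> mid m" for t
  proof (rule has_integral_spike_finite[where S = "{mid m}"])
    show "((\<lambda>x. v (level d (Suc m) (x + - gap m))) has_integral primitive v d (Suc m) (t - gap m)) {gap m..t}"
      using has_integral_shift_real_ivl[OF Suc.IH[of "t - gap m" "Suc m"], of "- gap m"] that by simp
  qed (use that in auto)
  have right: "(?f has_integral primitive v d (Suc m) (t - mid m)) {mid m..t}" if "mid m \<le> t" for t
  proof (rule has_integral_eq)
    show "((\<lambda>x. v (level d (Suc m) (x + - mid m))) has_integral primitive v d (Suc m) (t - mid m)) {mid m..t}"
      using has_integral_shift_real_ivl[OF Suc.IH[of "t - mid m" "Suc m"], of "- mid m"] that by simp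
  qed (use o that in auto)
  have G: "(?f has_integral v m * gap m) {0..gap m}" using gap[of "gap m"] o by simp
  consider "y \<le> gap m" | "gap m < y" "y \<le> mid m" | "mid m < y" by linarith
  then show ?case
  proof cases
    case 1
    then show ?thesis using gap[of y] Suc.prems by simp
  next
    case 2
    then have "(?f has_integral v m * gap m + primitive v d (Suc m) (y - gap m)) {0..y}"
      using o by (intro has_integral_combine[OF _ _ G left]) auto
    then show ?thesis using 2 by simp
  next
    case 3
    have "(?f has_integral v m * gap m + primitive v d (Suc m) (mid m - gap m)) {0..mid m}"
      using o by (intro has_integral_combine[OF _ _ G left]) auto
    then have M: "(?f has_integral v m * gap m + primitive v d (Suc m) (len (Suc m))) {0..mid m}"
      by (simp only: mid_minus_gap)
    have "(?f has_integral v m * gap m + primitive v d (Suc m) (len (Suc m))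
        + primitive v d (Suc m) (y - mid m)) {0..y}"
      using 3 o by (intro has_integral_combine[OF _ _ M right]) auto
    then show ?thesis using 3 o by simp
  qed
qed

lemma has_integral_level:
  assumes "0 \<le> u" "u \<le> y"
  shows "((\<lambda>x. v (level d m x)) has_integral primitive v d m y - primitive v d m u) {u..y}"
proof -
  let ?f = "\<lambda>x. v (level d m x)"
  have y: "(?f has_integral primitive v d m y) {0..y}" and u: "(?f has_integral primitive v d m u) {0..u}"
    using has_integral_level_initial assms by auto
  from has_integral_integrable[OF y] have "?f integrable_on {u..y}"
    by (rule integrable_subinterval_real) (use assms in simp)
  then obtain i where i: "(?f has_integral i) {u..y}" by blast
  have "primitive v d m u + i = primitive v d m y"
    using has_integral_unique[OF has_integral_combine[OF assms u i] y] .
  then have "i = primitive v d m y - primitive v d m u" by simp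
  with i show ?thesis by simp
qed

end

section \<open>Oscillation of the truncated profile\<close>

text \<open>
  From here on \<open>q\<close> is fixed, and \<open>val m\<close> is the value on gaps of level \<open>m\<close> of the function whose oscillation
  is measured.
\<close>
locale gap_tree_exponent = gap_tree +
  fixes q :: real
  assumes q_gt_1: "1 < q"
begin

definition val :: "nat \<Rightarrow> real" where
  "val m = height m powr (1 / q)"

text \<open>
  The bound for the average of the profile over a cell, relative to its smallest value there.
\<close>
definition cell_const :: real where
  "cell_const = q / (q - 1)"

text \<open>
  Up to a constant, the largest possible contribution of a jump from \<open>val m\<close> to \<open>val (Suc m)\<close>: its size is of order \<open>\<epsilon> m * val m\<close> and
  it takes place on the scale of the following gap. The factor \<open>8\<close> also covers the further jumps inside the child cell.
\<close>
definition atom :: "nat \<Rightarrow> real" where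
  "atom m = (8 * \<epsilon> m * val m) powr q * gap (Suc m)"

text \<open>
  The distribution function of the mass (uniform on the undivided cells at the bottom, with density \<open>height\<close>), plus
  an atom at the left end of each child cell. At an atom the function is left continuous, so it
  increases only to the right of that point.
\<close>
primrec charge :: "nat \<Rightarrow> nat \<Rightarrow> real \<Rightarrow> real" where
  "charge 0 m x = height m * x"
| "charge (Suc d) m x =
    (if x \<le> gap m then 0
     else if x \<le> mid m then atom m + charge d (Suc m) (x - gap m)
     else 2 * atom m + charge d (Suc m) (len (Suc m)) + charge d (Suc m) (x - mid m))"

lemma val_pos: "0 < val m"
  using height_pos[of m] by (simp add: val_def)

lemma val_powr: "val m powr q = height m"
  using height_pos[of m] q_gt_1 by (simp add: val_def powr_powr)

lemma val_mono: "m \<le> n \<Longrightarrow> val m \<le> val n"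
  unfolding val_def using height_mono height_pos[of m] q_gt_1 by (intro powr_mono2) auto

lemma val_Suc: "val (Suc m) = (1 + \<epsilon> m) powr (1 / q) * val m"
  using height_pos[of m] eps_pos[of m] by (simp add: val_def height_Suc powr_mult)

lemma val_Suc_le: "val (Suc m) \<le> (1 + \<epsilon> m) * val m"
proof -
  have "(1 + \<epsilon> m) powr (1 / q) \<le> (1 + \<epsilon> m) powr 1"
    using eps_pos[of m] q_gt_1 by (intro powr_mono) (auto simp: divide_simps)
  then show ?thesis unfolding val_Suc using val_pos[of m] eps_pos[of m] by simp
qed

lemma val_le_mix: "0 < c \<Longrightarrow> val m \<le> c + c powr (1 - q) * height m"
  unfolding val_def using root_le_mix[of c "height m" q] height_pos[of m] q_gt_1 by simp

lemma cell_const_ge_1: "1 \<le> cell_const"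
  using q_gt_1 by (simp add: cell_const_def divide_simps)

lemma atom_pos: "0 < atom m"
  using eps_pos[of m] val_pos[of m] gap_pos[of "Suc m"] by (simp add: atom_def)

text \<open>
  With \<open>r = 1 + \<epsilon> m\<close>, the gap takes the share \<open>1 - 1 / r\<close> of the cell and the children the share \<open>1 / r\<close>,
  on which the smallest value has grown by \<open>r powr (1 / q)\<close>. So the constant \<open>C\<close> is preserved by the induction if
  \<open>(1 - 1 / r) + C * r powr (1 / q - 1) \<le> C\<close>, and for \<open>C = q / (q - 1)\<close> this is the tangent
  inequality at \<open>1\<close>.
\<close>
lemma primitive_cell_le: "primitive val d m (len m) \<le> cell_const * len m * val m"
proof (induction d arbitrary: m)
  case 0
  then show ?case using cell_const_ge_1 len_pos[of m] val_pos[of m]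
    mult_right_mono[of 1 cell_const "len m * val m"] by (simp add: mult.commute mult.left_commute)
next
  case (Suc d)
  define r where "r = 1 + \<epsilon> m"
  have r: "1 < r" using eps_pos[of m] by (simp add: r_def)
  have tangent: "(1 / r) powr (1 - 1 / q) \<le> 1 + (1 - 1 / q) * (1 / r - 1)"
    using r q_gt_1 by (intro powr_le_tangent_at_1) (auto simp: divide_simps)
  have "r powr (1 / q) / r = (1 / r) powr (1 - 1 / q)"
    using r by (simp add: powr_divide powr_diff)
  then have "cell_const * (r powr (1 / q) / r) \<le> cell_const * (1 + (1 - 1 / q) * (1 / r - 1))"
    using tangent cell_const_ge_1 by (intro mult_left_mono) auto
  also have "cell_const * (1 + (1 - 1 / q) * (1 / r - 1)) = cell_const + (1 / r - 1)"
    using q_gt_1 by (simp add: cell_const_def field_simps)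
  finally have step: "(1 - 1 / r) + cell_const * (r powr (1 / q) / r) \<le> cell_const" by simp
  have l: "2 * len (Suc m) = len m / r" "gap m = len m * (1 - 1 / r)"
    using len_eq[of m] r unfolding gap_def r_def by (simp_all add: field_simps)
  have "primitive val (Suc d) m (len m) = val m * gap m + 2 * primitive val d (Suc m) (len (Suc m))"
    using tree_order[of m] len_minus_mid[of m] by simp
  also have "\<dots> \<le> val m * gap m + cell_const * (2 * len (Suc m)) * val (Suc m)"
    using Suc.IH[of "Suc m"] by simp
  also have "\<dots> = len m * val m * ((1 - 1 / r) + cell_const * (r powr (1 / q) / r))"
    unfolding l val_Suc r_def[symmetric] by (simp add: algebra_simps)
  also have "\<dots> \<le> len m * val m * cell_const"
    using step len_pos[of m] val_pos[of m] by (intro mult_left_mono) auto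
  finally show ?case by (simp add: mult_ac)
qed

lemma charge_at_0 [simp]: "charge d m 0 = 0"
  using tree_order(1)[of m] by (cases d) auto

lemma charge_mono: "0 \<le> x \<Longrightarrow> x \<le> y \<Longrightarrow> charge d m x \<le> charge d m y"
proof (induction d arbitrary: m x y)
  case 0
  then show ?case using height_pos[of m] by simp
next
  case (Suc d)
  note IH = Suc.IH[of _ _ "Suc m"]
  have nonneg: "0 \<le> charge d (Suc m) t" if "0 \<le> t" for t using IH[of 0 t] that by simp
  have cell: "charge d (Suc m) t \<le> charge d (Suc m) (len (Suc m))" if "0 \<le> t" "t \<le> len (Suc m)" for t
    using IH that by simp
  note o = tree_order[of m] atom_pos[of m] mid_minus_gap[of m]
  consider "y \<le> gap m" | "x \<le> gap m" "gap m < y" "y \<le> mid m" | "x \<le> gap m" "mid m < y"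
    | "gap m < x" "y \<le> mid m" | "gap m < x" "x \<le> mid m" "mid m < y" | "mid m < x"
    by linarith
  then show ?case
  proof cases
    case 2
    then show ?thesis using nonneg[of "y - gap m"] o by simp
  next
    case 3
    then show ?thesis using nonneg[of "len (Suc m)"] nonneg[of "y - mid m"] len_pos[of "Suc m"] o by simp
  next
    case 4
    then show ?thesis using IH[of "x - gap m" "y - gap m"] Suc.prems by simp
  next
    case 5
    then show ?thesis using cell[of "x - gap m"] nonneg[of "y - mid m"] o by simp
  next
    case 6
    then show ?thesis using IH[of "x - mid m" "y - mid m"] Suc.prems o by simp
  qed (use Suc.prems in auto)
qed

lemma charge_nonneg: "0 \<le> x \<Longrightarrow> 0 \<le> charge d m x"
  using charge_mono[of 0 x d m] by simp

lemma charge_Suc_cell: "charge (Suc d) m (len m) = 2 * atom m + 2 * charge d (Suc m) (len (Suc m))"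
  using tree_order[of m] len_minus_mid[of m] by simp

lemma charge_cell_ge: "height m * len m \<le> charge d m (len m)"
proof (induction d arbitrary: m)
  case (Suc d)
  have "height m * len m = 2 * (height (Suc m) * len (Suc m))" by (simp add: height_len)
  then show ?case unfolding charge_Suc_cell using Suc[of "Suc m"] atom_pos[of m] by simp
qed simp

lemma primitive_cell_le_charge:
  assumes c: "0 < c"
  shows "primitive val d m (len m) \<le> cell_const * (c * len m + c powr (1 - q) * charge d m (len m))"
proof -
  have "val m * len m \<le> (c + c powr (1 - q) * height m) * len m"
    using val_le_mix[OF c, of m] len_pos[of m] by (intro mult_right_mono) auto
  also have "\<dots> = c * len m + c powr (1 - q) * (height m * len m)" by (simp add: algebra_simps)
  also have "\<dots> \<le> c * len m + c powr (1 - q) * charge d m (len m)"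
    using charge_cell_ge[of m d] by (intro add_left_mono mult_left_mono) auto
  finally have "cell_const * (val m * len m) \<le> cell_const * (c * len m + c powr (1 - q) * charge d m (len m))"
    using cell_const_ge_1 by (intro mult_left_mono) auto
  then show ?thesis using primitive_cell_le[of d m] by (simp add: mult_ac)
qed

lemma primitive_cell_le_twice_charge:
  assumes c: "0 < c"
  shows "primitive val d m (len m) \<le> 2 * cell_const * (c * len m + c powr (1 - q) * charge d m (len m))"
proof -
  have "0 \<le> cell_const * (c * len m + c powr (1 - q) * charge d m (len m))"
    using cell_const_ge_1 c len_pos[of m] charge_nonneg[of "len m" d m] by simp
  with primitive_cell_le_charge[OF c, of d m] show ?thesis by linarith
qed

text \<open>
  A final segment that starts inside a child cell consists of a final segment of that child and possibly the whole
  second child. If it starts inside the gap, it is at least half as long as the cell and has all its mass, so that the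
  bound for the whole cell applies, with twice the constant. No jump terms appear, in contrast to initial segments.
\<close>
lemma primitive_final_segment_le:
  assumes c: "0 < c" and u: "0 \<le> u" "u \<le> len m"
  shows "primitive val d m (len m) - primitive val d m u
    \<le> 2 * cell_const * (c * (len m - u) + c powr (1 - q) * (charge d m (len m) - charge d m u))"
  using u
proof (induction d arbitrary: m u)
  case 0
  have "val m * (len m - u) \<le> (c + c powr (1 - q) * height m) * (len m - u)"
    using val_le_mix[OF c, of m] 0 by (intro mult_right_mono) auto
  also have "\<dots> \<le> (2 * cell_const) * ((c + c powr (1 - q) * height m) * (len m - u))"
    using cell_const_ge_1 c height_pos[of m] 0 mult_right_mono[of 1 "2 * cell_const" "(c + c powr (1 - q) * height m) * (len m - u)"]
    by simp
  finally show ?case by (simp add: algebra_simps)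
next
  case (Suc d)
  define D where "D = c powr (1 - q)"
  have D: "0 \<le> D" by (simp add: D_def)
  note o = tree_order[of m] mid_minus_gap[of m] len_minus_mid[of m]
  note cell = primitive_cell_le_charge[OF c, folded D_def]
  note IH = Suc.IH[of _ "Suc m", folded D_def]
  have C: "0 < cell_const" using cell_const_ge_1 by simp
  have "primitive val (Suc d) m (len m) - primitive val (Suc d) m u
    \<le> 2 * cell_const * (c * (len m - u) + D * (charge (Suc d) m (len m) - charge (Suc d) m u))"
  proof -
    consider "u \<le> gap m" | "gap m < u" "u \<le> mid m" | "mid m < u" by linarith
    then show ?thesis
    proof cases
      case 1
      have "primitive val (Suc d) m (len m) - primitive val (Suc d) m u \<le> primitive val (Suc d) m (len m)"
        using 1 Suc.prems val_pos[of m] by simp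
      also have "\<dots> \<le> cell_const * (c * len m + D * charge (Suc d) m (len m))"
        by (rule cell)
      also have "\<dots> \<le> cell_const * (c * (2 * (len m - u)) + D * (2 * (charge (Suc d) m (len m) - 0)))"
      proof -
        have "len m \<le> 2 * (len m - u)"
          using 1 gap_le_len_Suc[of m] o by (simp add: mid_def)
        then show ?thesis using C c D charge_nonneg[of "len m" "Suc d" m] len_pos[of m]
          by (intro mult_left_mono add_mono) auto
      qed
      also have "\<dots> = 2 * cell_const * (c * (len m - u) + D * (charge (Suc d) m (len m) - 0))"
        by (simp only: distrib_left mult_ac)
      finally have "primitive val (Suc d) m (len m) - primitive val (Suc d) m u \<le> \<dots>" .
      moreover have "charge (Suc d) m u = 0" using 1 by simp
      ultimately show ?thesis by (simp only: diff_zero)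
    next
      case 2
      have P: "primitive val (Suc d) m (len m) - primitive val (Suc d) m u
          = (primitive val d (Suc m) (len (Suc m)) - primitive val d (Suc m) (u - gap m)) + primitive val d (Suc m) (len (Suc m))"
        using 2 o by simp
      have N: "charge (Suc d) m (len m) - charge (Suc d) m u
          = (charge d (Suc m) (len (Suc m)) - charge d (Suc m) (u - gap m)) + charge d (Suc m) (len (Suc m)) + atom m"
        using 2 o by simp
      have "primitive val d (Suc m) (len (Suc m)) - primitive val d (Suc m) (u - gap m)
        \<le> 2 * cell_const * (c * (len (Suc m) - (u - gap m)) + D * (charge d (Suc m) (len (Suc m)) - charge d (Suc m) (u - gap m)))"
        using IH[of "u - gap m"] 2 o by simp
      moreover have "primitive val d (Suc m) (len (Suc m))
        \<le> 2 * cell_const * (c * len (Suc m) + D * charge d (Suc m) (len (Suc m)))"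
      by (rule primitive_cell_le_twice_charge[OF c, folded D_def])
      moreover have "0 \<le> 2 * cell_const * (D * atom m)"
        using C D atom_pos[of m] by simp
      moreover have "len m - u = (len (Suc m) - (u - gap m)) + len (Suc m)" using o by simp
      ultimately show ?thesis unfolding P N by (simp only: distrib_left)
    next
      case 3
      have "primitive val (Suc d) m (len m) - primitive val (Suc d) m u
          = primitive val d (Suc m) (len (Suc m)) - primitive val d (Suc m) (u - mid m)"
        "charge (Suc d) m (len m) - charge (Suc d) m u
          = charge d (Suc m) (len (Suc m)) - charge d (Suc m) (u - mid m)"
        "len m - u = len (Suc m) - (u - mid m)"
        using 3 o by simp_all
      then show ?thesis using IH[of "u - mid m"] 3 Suc.prems o by (simp only:)
    qed
  qed
  then show ?case by (simp only: D_def)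
qed

text \<open>
  An initial segment may consist mostly of gaps of increasing levels and then carry no mass: every cell begins
  with a gap, and so does its first child. As each of these gaps is at most half as long as the
  previous one while the values grow slowly, the excess over \<open>b\<close> on all of them is controlled by the first.
  This is the last term. The weight \<open>2 * (val m - b) + 4 * \<epsilon> m * val m\<close> is chosen to reproduce
  itself: half of it at the next level, plus \<open>val m - b\<close>, is at most itself.
\<close>
lemma primitive_initial_segment_le:
  assumes c: "0 < c" and b: "0 \<le> b" "b \<le> val m" and y: "0 \<le> y" "y \<le> len m"
  shows "primitive val d m y - b * y
    \<le> 2 * cell_const * (c * y + c powr (1 - q) * charge d m y)
      + (2 * (val m - b) + 4 * \<epsilon> m * val m) * min y (gap m)"
  using b y
proof (induction d arbitrary: m y)
  case 0
  have "val m * y \<le> (c + c powr (1 - q) * height m) * y"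
    using val_le_mix[OF c, of m] 0 by (intro mult_right_mono) auto
  also have "\<dots> \<le> (2 * cell_const) * ((c + c powr (1 - q) * height m) * y)"
    using cell_const_ge_1 c height_pos[of m] 0 mult_right_mono[of 1 "2 * cell_const" "(c + c powr (1 - q) * height m) * y"]
    by simp
  also have "\<dots> = 2 * cell_const * (c * y + c powr (1 - q) * charge 0 m y)" by (simp add: algebra_simps)
  finally have "val m * y \<le> 2 * cell_const * (c * y + c powr (1 - q) * charge 0 m y)" .
  moreover have "0 \<le> b * y" "0 \<le> (2 * (val m - b) + 4 * \<epsilon> m * val m) * min y (gap m)"
    using 0 val_pos[of m] eps_pos[of m] gap_pos[of m] by auto
  ultimately show ?case by simp
next
  case (Suc d)
  define D where "D = c powr (1 - q)"
  have D: "0 \<le> D" by (simp add: D_def)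
  define \<beta> where "\<beta> k = 2 * (val k - b) + 4 * \<epsilon> k * val k" for k
  note o = tree_order[of m] mid_minus_gap[of m] len_minus_mid[of m] gap_pos[of "Suc m"]
  note cell = primitive_cell_le_charge[OF c, folded D_def]
  have C: "0 < cell_const" using cell_const_ge_1 by simp
  have v: "val m \<le> val (Suc m)" using val_mono by simp
  note IH = Suc.IH[of "Suc m", folded D_def, folded \<beta>_def, OF Suc.prems(1) order_trans[OF Suc.prems(2) v]]
  have vb: "0 \<le> val m - b" using Suc.prems by simp
  have ev: "0 < \<epsilon> m * val m" using eps_pos[of m] val_pos[of m] by simp
  have beta_Suc: "\<beta> (Suc m) \<le> 2 * (val m - b) + 8 * \<epsilon> m * val m"
  proof -
    have "(1 + \<epsilon> m) * val m \<le> 3 / 2 * val m"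
      using eps_le_half[of m] val_pos[of m] by (intro mult_right_mono) auto
    with val_Suc_le[of m] have "val (Suc m) \<le> 3 / 2 * val m" by linarith
    then have "\<epsilon> (Suc m) * val (Suc m) \<le> \<epsilon> m * (3 / 2 * val m)"
      using eps_Suc_le[of m] eps_pos[of m] val_pos[of "Suc m"] by (intro mult_mono) auto
    then show ?thesis unfolding \<beta>_def using val_Suc_le[of m] by (simp add: algebra_simps)
  qed
  have beta_Suc_nonneg: "0 \<le> \<beta> (Suc m)"
    unfolding \<beta>_def using vb v eps_pos[of "Suc m"] val_pos[of "Suc m"] by simp
  \<comment> \<open>The weight reproduces itself: the excess on this gap plus the bound at the next level, where gaps are half as long.\<close>
  have absorb: "(val m - b) * gap m + \<beta> (Suc m) * min t (gap (Suc m)) \<le> \<beta> m * gap m" for t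
  proof -
    have "\<beta> (Suc m) * min t (gap (Suc m)) \<le> \<beta> (Suc m) * (gap m / 2)"
      using beta_Suc_nonneg gap_Suc_le[of m] by (intro mult_left_mono) auto
    also have "\<dots> \<le> (2 * (val m - b) + 8 * \<epsilon> m * val m) * (gap m / 2)"
      using beta_Suc o by (intro mult_right_mono) auto
    finally show ?thesis unfolding \<beta>_def by (simp add: algebra_simps)
  qed
  have atom: "0 \<le> 2 * cell_const * (D * atom m)" "0 \<le> 2 * cell_const * (c * gap m)"
    using C D c atom_pos[of m] gap_pos[of m] by simp_all
  consider "y \<le> gap m" | "gap m < y" "y \<le> mid m" | "mid m < y" by linarith
  then show ?case unfolding D_def[symmetric] \<beta>_def[symmetric]
  proof cases
    case 1
    have "(val m - b) * y \<le> \<beta> m * y"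
      using vb ev Suc.prems unfolding \<beta>_def by (intro mult_right_mono) auto
    moreover have nonneg: "0 \<le> 2 * cell_const * (c * y)" using C c Suc.prems by simp
    ultimately show "primitive val (Suc d) m y - b * y
      \<le> 2 * cell_const * (c * y + D * charge (Suc d) m y) + \<beta> m * min y (gap m)"
      using 1 nonneg by (simp add: algebra_simps)
  next
    case 2
    have P: "primitive val (Suc d) m y - b * y = (val m - b) * gap m
        + (primitive val d (Suc m) (y - gap m) - b * (y - gap m))"
      using 2 o by (simp add: algebra_simps)
    have N: "charge (Suc d) m y = atom m + charge d (Suc m) (y - gap m)"
      using 2 o by simp
    have Y: "c * y = c * gap m + c * (y - gap m)" by (simp add: algebra_simps)
    have M: "min y (gap m) = gap m" using 2 by simp
    show "primitive val (Suc d) m y - b * y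
      \<le> 2 * cell_const * (c * y + D * charge (Suc d) m y) + \<beta> m * min y (gap m)"
      unfolding P N Y M
      using IH[of "y - gap m"] 2 o absorb[of "y - gap m"] atom by (simp only: distrib_left) linarith
  next
    case 3
    have P: "primitive val (Suc d) m y - b * y = (val m - b) * gap m
        + (primitive val d (Suc m) (len (Suc m)) - b * len (Suc m))
        + (primitive val d (Suc m) (y - mid m) - b * (y - mid m))"
      using 3 o by (simp add: algebra_simps)
    have N: "charge (Suc d) m y = 2 * atom m + charge d (Suc m) (len (Suc m)) + charge d (Suc m) (y - mid m)"
      using 3 o by simp
    have Y: "c * y = c * gap m + c * len (Suc m) + c * (y - mid m)"
      unfolding mid_def by (simp add: algebra_simps)
    have M: "min y (gap m) = gap m" using 3 o by simp
    have b': "0 \<le> b * len (Suc m)" using Suc.prems len_pos[of "Suc m"] by simp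
    have "primitive val d (Suc m) (len (Suc m))
      \<le> 2 * cell_const * (c * len (Suc m) + D * charge d (Suc m) (len (Suc m)))"
      by (rule primitive_cell_le_twice_charge[OF c, folded D_def])
    then show "primitive val (Suc d) m y - b * y
      \<le> 2 * cell_const * (c * y + D * charge (Suc d) m y) + \<beta> m * min y (gap m)"
      unfolding P N Y M
      using IH[of "y - mid m"] 3 o Suc.prems absorb[of "y - mid m"] atom b' by (simp only: distrib_left) linarith
  qed
qed

definition energy_const :: real where
  "energy_const = (4 * cell_const + 1) powr q"

text \<open>
  Here \<open>P\<close> is the integral of the truncated profile minus \<open>val m\<close> over an interval of length \<open>L\<close> whose increment of the
  charge is \<open>N\<close>, and which contains the left end of a child cell; \<open>s\<close> is the length of its part in that
  child. The choice \<open>c powr q * L = N\<close> balances length and charge, and the jump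
  term is at most \<open>c * L\<close> because \<open>N\<close> includes the atom.
\<close>
lemma oscillation_le_charge_crossing:
  fixes P N L s :: real
  assumes excess: "\<And>c. 0 < c \<Longrightarrow> P \<le> 2 * cell_const * (c * L + c powr (1 - q) * (N - atom m))
      + (2 * (val (Suc m) - val m) + 4 * \<epsilon> (Suc m) * val (Suc m)) * min s (gap (Suc m))"
    and L: "0 < L" "0 \<le> s" "s \<le> L" and N: "atom m \<le> N" and P: "0 \<le> P"
  shows "L * (P / L) powr q \<le> energy_const * N"
proof -
  \<comment> \<open>The choice that balances the two terms of the linearised Hoelder inequality.\<close>
  define c where "c = (N / L) powr (1 / q)"
  have Npos: "0 < N" using N atom_pos[of m] by simp
  have c: "0 < c" using Npos L by (simp add: c_def)
  have cq: "c powr q * L = N" using Npos L q_gt_1 by (simp add: c_def powr_powr)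
  have ev: "0 < \<epsilon> m * val m" using eps_pos[of m] val_pos[of m] by simp
  have "c powr (1 - q) * N = (c powr (1 - q) * c powr q) * L" by (simp add: cq[symmetric])
  also have "\<dots> = c * L" using c by (simp flip: powr_add)
  finally have cN: "c powr (1 - q) * N = c * L" .
  have "c powr (1 - q) * (N - atom m) \<le> c powr (1 - q) * N"
    using atom_pos[of m] by (intro mult_left_mono) auto
  then have "c * L + c powr (1 - q) * (N - atom m) \<le> c * L + c * L" using cN by linarith
  then have first: "2 * cell_const * (c * L + c powr (1 - q) * (N - atom m)) \<le> 2 * cell_const * (c * L + c * L)"
    using cell_const_ge_1 by (intro mult_left_mono) auto
  have beta: "2 * (val (Suc m) - val m) + 4 * \<epsilon> (Suc m) * val (Suc m) \<le> 8 * \<epsilon> m * val m"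
  proof -
    have "(1 + \<epsilon> m) * val m \<le> 3 / 2 * val m"
      using eps_le_half[of m] val_pos[of m] by (intro mult_right_mono) auto
    with val_Suc_le[of m] have "val (Suc m) \<le> 3 / 2 * val m" by linarith
    then have "\<epsilon> (Suc m) * val (Suc m) \<le> \<epsilon> m * (3 / 2 * val m)"
      using eps_Suc_le[of m] eps_pos[of m] val_pos[of "Suc m"] by (intro mult_mono) auto
    then show ?thesis using val_Suc_le[of m] by (simp add: algebra_simps)
  qed
  define t where "t = min s (gap (Suc m))"
  have t: "0 \<le> t" "t \<le> L" "t \<le> gap (Suc m)" using L gap_pos[of "Suc m"] by (auto simp: t_def)
  \<comment> \<open>Compare \<open>q\<close>-th powers: \<open>t\<close> is at most the gap once and at most \<open>L\<close> for the remaining \<open>q - 1\<close> factors.\<close>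
  have jump: "8 * \<epsilon> m * val m * t \<le> c * L"
  proof (cases "t = 0")
    case False
    with t have tpos: "0 < t" by simp
    have "(8 * \<epsilon> m * val m * t) powr q = (8 * \<epsilon> m * val m) powr q * (t * t powr (q - 1))"
      using ev tpos by (simp add: powr_mult powr_diff)
    also have "\<dots> \<le> (8 * \<epsilon> m * val m) powr q * (gap (Suc m) * L powr (q - 1))"
      using t tpos q_gt_1 by (intro mult_left_mono mult_mono powr_mono2) auto
    also have "\<dots> = atom m * L powr (q - 1)" by (simp add: atom_def)
    also have "\<dots> \<le> N * L powr (q - 1)" using N by (intro mult_right_mono) auto
    also have "\<dots> = (c * L) powr q" using c L by (simp add: cq[symmetric] powr_mult powr_diff)
    finally have "(8 * \<epsilon> m * val m * t) powr q \<le> (c * L) powr q" .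
    moreover have "(c * L) powr q < (8 * \<epsilon> m * val m * t) powr q" if "c * L < 8 * \<epsilon> m * val m * t"
      using that c L q_gt_1 by (intro powr_less_mono2) auto
    ultimately show ?thesis by fastforce
  qed (use c L in simp)
  have "P \<le> 2 * cell_const * (c * L + c * L) + c * L"
    using excess[OF c] first jump mult_right_mono[OF beta t(1)] unfolding t_def by linarith
  also have "\<dots> = (4 * cell_const + 1) * (c * L)" by (simp add: algebra_simps)
  finally have "P / L \<le> (4 * cell_const + 1) * c" using L by (simp add: field_simps)
  then have "(P / L) powr q \<le> ((4 * cell_const + 1) * c) powr q"
    using P L q_gt_1 by (intro powr_mono2) auto
  also have "\<dots> = energy_const * c powr q"
    using c cell_const_ge_1 by (simp add: energy_const_def powr_mult)
  finally have "L * (P / L) powr q \<le> L * (energy_const * c powr q)"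
    using L by (intro mult_left_mono) auto
  also have "\<dots> = energy_const * N" by (simp add: cq[symmetric])
  finally show ?thesis .
qed

text \<open>
  Descend to the smallest cell containing the interval. There either the interval lies in the gap (or the cell is not subdivided) and
  the truncated profile is constant, or it contains the left end of a child cell. To the right of that point (of the last one if
  there are two) it is an initial segment of a child, and before it there is part of the gap, a final segment of the
  first child, or the whole first child with part of the gap.
\<close>
lemma oscillation_le_charge:
  assumes "0 \<le> u" "u < y" "y \<le> len m"
  shows "\<exists>b. (\<forall>x. u \<le> x \<and> x < y \<longrightarrow> b \<le> val (level d m x)) \<and>
    (y - u) * ((primitive val d m y - primitive val d m u - b * (y - u)) / (y - u)) powr q
      \<le> energy_const * (charge d m y - charge d m u)"
  using assms
proof (induction d arbitrary: m u y)
  case 0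
  then have "0 \<le> energy_const * (charge 0 m y - charge 0 m u)"
    using height_pos[of m] by (simp add: energy_const_def)
  then show ?case using q_gt_1 by (intro exI[of _ "val m"]) (simp add: algebra_simps)
next
  case (Suc d)
  note o = tree_order[of m] mid_minus_gap[of m] len_minus_mid[of m] len_pos[of "Suc m"]
  have C: "0 < cell_const" using cell_const_ge_1 by simp
  have v: "0 \<le> val m" "val m \<le> val (Suc m)" using val_mono val_pos[of m] by auto
  let ?P = "primitive val (Suc d) m y - primitive val (Suc d) m u - val m * (y - u)"
  let ?N = "charge (Suc d) m y - charge (Suc d) m u"
  let ?p = "primitive val d (Suc m)" and ?n = "charge d (Suc m)"
  have crossing: ?case
    if bound: "\<And>c. 0 < c \<Longrightarrow> ?P \<le> 2 * cell_const * (c * (y - u) + c powr (1 - q) * (?N - atom m))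
      + (2 * (val (Suc m) - val m) + 4 * \<epsilon> (Suc m) * val (Suc m)) * min s (gap (Suc m))"
      and s: "0 \<le> s" "s \<le> y - u" and N: "atom m \<le> ?N" for s
  proof -
    have above: "val m \<le> val (level (Suc d) m x)" for x
      by (intro val_mono level_ge)
    have "val m * (y - u) \<le> primitive val (Suc d) m y - primitive val (Suc d) m u"
      using has_integral_le[OF has_integral_const_real[of "val m" u y] has_integral_level[of u y val "Suc d" m]]
        above Suc.prems by (simp add: mult.commute del: primitive.simps level.simps)
    then have "0 \<le> ?P" by simp
    with oscillation_le_charge_crossing[of ?P "y - u" ?N m s] bound s N Suc.prems above show ?thesis
      by (intro exI[of _ "val m"] conjI) auto
  qed
  have init: "?p t - val m * t \<le> 2 * cell_const * (c * t + c powr (1 - q) * ?n t)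
      + (2 * (val (Suc m) - val m) + 4 * \<epsilon> (Suc m) * val (Suc m)) * min t (gap (Suc m))"
    if "0 < c" "0 \<le> t" "t \<le> len (Suc m)" for c t
    using primitive_initial_segment_le[of c "val m" "Suc m" t d] that v by simp
  have final: "?p (len (Suc m)) - ?p t
      \<le> 2 * cell_const * (c * (len (Suc m) - t) + c powr (1 - q) * (?n (len (Suc m)) - ?n t))"
    if "0 < c" "0 \<le> t" "t \<le> len (Suc m)" for c t
    using primitive_final_segment_le[of c t "Suc m" d] that by simp
  have nonneg: "0 \<le> 2 * cell_const * (c powr (1 - q) * atom m)" for c
    using C atom_pos[of m] by simp
  consider (gap) "y \<le> gap m" | (left) "gap m \<le> u" "y \<le> mid m" | (right) "mid m \<le> u"
    | (gap_left) "u < gap m" "gap m < y" "y \<le> mid m" | (gap_right) "u < gap m" "mid m < y"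
    | (left_right) "gap m \<le> u" "u < mid m" "mid m < y"
    using o by linarith
  then show ?case
  proof cases
    case gap
    then have "?P = 0" "?N = 0" using Suc.prems by (simp_all add: algebra_simps)
    moreover have "\<forall>x. u \<le> x \<and> x < y \<longrightarrow> val m \<le> val (level (Suc d) m x)" using gap by simp
    ultimately show ?thesis using q_gt_1 by (intro exI[of _ "val m"] conjI) simp_all
  next
    case left
    obtain b where b: "\<And>x. u - gap m \<le> x \<Longrightarrow> x < y - gap m \<Longrightarrow> b \<le> val (level d (Suc m) x)"
      "(y - u) * ((?p (y - gap m) - ?p (u - gap m) - b * (y - u)) / (y - u)) powr q
        \<le> energy_const * (?n (y - gap m) - ?n (u - gap m))"
      using Suc.IH[of "u - gap m" "y - gap m" "Suc m"] left Suc.prems o by auto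
    have "primitive val (Suc d) m y - primitive val (Suc d) m u = ?p (y - gap m) - ?p (u - gap m)"
      using left Suc.prems by simp
    moreover have "?n (y - gap m) - ?n (u - gap m) \<le> ?N"
      using left Suc.prems atom_pos[of m] by simp
    then have "energy_const * (?n (y - gap m) - ?n (u - gap m)) \<le> energy_const * ?N"
      by (intro mult_left_mono) (auto simp: energy_const_def)
    moreover have "\<forall>x. u \<le> x \<and> x < y \<longrightarrow> b \<le> val (level (Suc d) m x)"
      using left b(1) by simp
    ultimately show ?thesis using b(2) by (intro exI[of _ b] conjI) (assumption, simp only:)
  next
    case right
    obtain b where b: "\<And>x. u - mid m \<le> x \<Longrightarrow> x < y - mid m \<Longrightarrow> b \<le> val (level d (Suc m) x)"
      "(y - u) * ((?p (y - mid m) - ?p (u - mid m) - b * (y - u)) / (y - u)) powr q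
        \<le> energy_const * (?n (y - mid m) - ?n (u - mid m))"
      using Suc.IH[of "u - mid m" "y - mid m" "Suc m"] right Suc.prems o by auto
    have "primitive val (Suc d) m y - primitive val (Suc d) m u = ?p (y - mid m) - ?p (u - mid m)"
      using right Suc.prems o by simp
    moreover have "?n (y - mid m) - ?n (u - mid m) \<le> ?N"
      using right Suc.prems atom_pos[of m] o by simp
    then have "energy_const * (?n (y - mid m) - ?n (u - mid m)) \<le> energy_const * ?N"
      by (intro mult_left_mono) (auto simp: energy_const_def)
    moreover have "\<forall>x. u \<le> x \<and> x < y \<longrightarrow> b \<le> val (level (Suc d) m x)"
      using right b(1) o by simp
    ultimately show ?thesis using b(2) by (intro exI[of _ b] conjI) (assumption, simp only:)
  next
    case gap_left
    have P: "?P = ?p (y - gap m) - val m * (y - gap m)"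
      using gap_left o by (simp add: algebra_simps)
    have N: "?N = ?n (y - gap m) + atom m" using gap_left o by simp
    show ?thesis
    proof (rule crossing[of "y - gap m"])
      fix c :: real assume c: "0 < c"
      have "2 * cell_const * (c * (y - gap m) + c powr (1 - q) * ?n (y - gap m))
        \<le> 2 * cell_const * (c * (y - u) + c powr (1 - q) * ?n (y - gap m))"
        using C c gap_left by (intro mult_left_mono add_right_mono) auto
      then show "?P \<le> 2 * cell_const * (c * (y - u) + c powr (1 - q) * (?N - atom m))
        + (2 * (val (Suc m) - val m) + 4 * \<epsilon> (Suc m) * val (Suc m)) * min (y - gap m) (gap (Suc m))"
        unfolding P N using init[OF c, of "y - gap m"] gap_left o by simp
    qed (use gap_left charge_nonneg[of "y - gap m" d "Suc m"] N in auto)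
  next
    case gap_right
    have P: "?P = (?p (len (Suc m)) - val m * len (Suc m)) + (?p (y - mid m) - val m * (y - mid m))"
      using gap_right o by (simp add: algebra_simps)
    have N: "?N = ?n (len (Suc m)) + ?n (y - mid m) + 2 * atom m" using gap_right o by simp
    show ?thesis
    proof (rule crossing[of "y - mid m"])
      fix c :: real assume c: "0 < c"
      have "c * (len (Suc m) + (y - mid m)) \<le> c * (y - u)"
        using c gap_right o by (intro mult_left_mono) auto
      then have len: "2 * cell_const * (c * len (Suc m)) + 2 * cell_const * (c * (y - mid m)) \<le> 2 * cell_const * (c * (y - u))"
        using C by (simp flip: distrib_left)
      have "?p (len (Suc m)) \<le> 2 * cell_const * (c * len (Suc m) + c powr (1 - q) * ?n (len (Suc m)))"
        using final[OF c, of 0] o by simp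
      moreover have "0 \<le> val m * len (Suc m)" using v o by simp
      moreover have "2 * cell_const * (c * (y - u) + c powr (1 - q) * (?N - atom m))
        = 2 * cell_const * (c * (y - u)) + 2 * cell_const * (c powr (1 - q) * ?n (len (Suc m)))
          + 2 * cell_const * (c powr (1 - q) * ?n (y - mid m)) + 2 * cell_const * (c powr (1 - q) * atom m)"
        unfolding N by (simp add: algebra_simps)
      ultimately show "?P \<le> 2 * cell_const * (c * (y - u) + c powr (1 - q) * (?N - atom m))
        + (2 * (val (Suc m) - val m) + 4 * \<epsilon> (Suc m) * val (Suc m)) * min (y - mid m) (gap (Suc m))"
        unfolding P using init[OF c, of "y - mid m"] gap_right o Suc.prems len nonneg[of c]
        by (simp only: distrib_left) linarith
    qed (use gap_right o charge_nonneg[of "len (Suc m)" d "Suc m"] charge_nonneg[of "y - mid m" d "Suc m"] N atom_pos[of m] in auto)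
  next
    case left_right
    have P: "?P = (?p (len (Suc m)) - ?p (u - gap m) - val m * (mid m - u)) + (?p (y - mid m) - val m * (y - mid m))"
      using left_right o by (cases "u = gap m") (simp_all add: algebra_simps)
    have N: "?n (len (Suc m)) - ?n (u - gap m) + ?n (y - mid m) + atom m \<le> ?N"
      using left_right o atom_pos[of m] by (cases "u = gap m") simp_all
    show ?thesis
    proof (rule crossing[of "y - mid m"])
      fix c :: real assume c: "0 < c"
      have "?p (len (Suc m)) - ?p (u - gap m)
        \<le> 2 * cell_const * (c * (mid m - u) + c powr (1 - q) * (?n (len (Suc m)) - ?n (u - gap m)))"
        using final[OF c, of "u - gap m"] left_right o by (simp add: algebra_simps)
      moreover have "0 \<le> val m * (mid m - u)" using v left_right by simp
      moreover have "2 * cell_const * (c * (mid m - u) + c powr (1 - q) * (?n (len (Suc m)) - ?n (u - gap m)))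
          + 2 * cell_const * (c * (y - mid m) + c powr (1 - q) * ?n (y - mid m))
        \<le> 2 * cell_const * (c * (y - u) + c powr (1 - q) * (?N - atom m))"
      proof -
        have "c powr (1 - q) * (?n (len (Suc m)) - ?n (u - gap m) + ?n (y - mid m)) \<le> c powr (1 - q) * (?N - atom m)"
          using N by (intro mult_left_mono) auto
        then have "c * (y - u) + c powr (1 - q) * (?n (len (Suc m)) - ?n (u - gap m) + ?n (y - mid m))
          \<le> c * (y - u) + c powr (1 - q) * (?N - atom m)" by simp
        from mult_left_mono[OF this, of "2 * cell_const"] C show ?thesis by (simp add: algebra_simps)
      qed
      ultimately show "?P \<le> 2 * cell_const * (c * (y - u) + c powr (1 - q) * (?N - atom m))
        + (2 * (val (Suc m) - val m) + 4 * \<epsilon> (Suc m) * val (Suc m)) * min (y - mid m) (gap (Suc m))"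
        unfolding P using init[OF c, of "y - mid m"] left_right o Suc.prems by linarith
    next
      show "atom m \<le> ?N"
        using N charge_mono[of "u - gap m" "len (Suc m)" d "Suc m"] charge_nonneg[of "y - mid m" d "Suc m"] left_right o
        by simp
    qed (use left_right in auto)
  qed
qed

text \<open>
  Normalised by the number of cells, one generation adds \<open>2 ^ Suc m * atom m\<close>, which is at most
  \<open>8 powr q * \<epsilon> m powr (q + 1)\<close> as twice the following gap is at most \<open>\<epsilon> m * len m\<close> and \<open>2 ^ m * height m * len m = 1\<close>.
\<close>
lemma charge_root_le: "charge d m (len m) * 2 ^ m \<le> 1 + 8 powr q * (\<Sum>j<d. \<epsilon> (m + j) powr (q + 1))"
proof (induction d arbitrary: m)
  case 0
  then show ?case by (simp add: height_len)
next
  case (Suc d)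
  have "gap m \<le> \<epsilon> m * len m"
    using mult_left_mono[OF len_Suc_le[of m], of "\<epsilon> m"] eps_pos[of m] by (simp add: gap_def)
  with gap_Suc_le[of m] have "gap (Suc m) * 2 \<le> \<epsilon> m * len m" by linarith
  from mult_right_mono[OF this, of "2 ^ m"]
  have "gap (Suc m) * 2 ^ Suc m \<le> \<epsilon> m * (len m * 2 ^ m)" by (simp add: mult_ac)
  then have "height m * (gap (Suc m) * 2 ^ Suc m) \<le> height m * (\<epsilon> m * (len m * 2 ^ m))"
    using height_pos[of m] by (intro mult_left_mono) auto
  also have "\<dots> = \<epsilon> m" using height_len[of m] by (simp add: field_simps)
  finally have "8 powr q * \<epsilon> m powr q * (height m * (gap (Suc m) * 2 ^ Suc m)) \<le> 8 powr q * \<epsilon> m powr q * \<epsilon> m"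
    by (intro mult_left_mono) auto
  moreover have "atom m * 2 ^ Suc m = 8 powr q * \<epsilon> m powr q * (height m * (gap (Suc m) * 2 ^ Suc m))"
    using eps_pos[of m] val_pos[of m] by (simp add: atom_def powr_mult val_powr)
  ultimately have "atom m * 2 ^ Suc m \<le> 8 powr q * \<epsilon> m powr (q + 1)"
    using eps_pos[of m] by (simp add: powr_add)
  moreover have "charge (Suc d) m (len m) * 2 ^ m = atom m * 2 ^ Suc m + charge d (Suc m) (len (Suc m)) * 2 ^ Suc m"
    unfolding charge_Suc_cell by (simp add: algebra_simps)
  moreover have "charge d (Suc m) (len (Suc m)) * 2 ^ Suc m \<le> 1 + 8 powr q * (\<Sum>j<d. \<epsilon> (m + Suc j) powr (q + 1))"
    using Suc.IH[of "Suc m"] by simp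
  ultimately show ?case by (simp add: sum.lessThan_Suc_shift algebra_simps del: sum.lessThan_Suc power_Suc)
qed

end

section \<open>The limiting profile\<close>

context gap_tree
begin

text \<open>
  A level is final once it is smaller than the truncation depth. Points in no gap form a null set, and the
  value there is irrelevant.
\<close>
definition limit_level :: "real \<Rightarrow> nat" where
  "limit_level x = (LEAST k. \<exists>d>k. level d 0 x = k)"

lemma limit_level_eq:
  assumes "level d 0 x < d"
  shows "limit_level x = level d 0 x"
  unfolding limit_level_def
proof (rule Least_equality)
  show "\<exists>e>level d 0 x. level e 0 x = level d 0 x" using assms by blast
next
  fix k assume "\<exists>e>k. level e 0 x = k"
  then obtain e where e: "level e 0 x < e" "level e 0 x = k" by auto
  have "level (max d e) 0 x = level d 0 x" "level (max d e) 0 x = level e 0 x"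
    using level_stable[of d 0 x "max d e"] level_stable[of e 0 x "max d e"] assms e(1) by simp_all
  then show "level d 0 x \<le> k" using e by simp
qed

lemma limit_level_eq_later: "level d 0 x < d \<Longrightarrow> d \<le> e \<Longrightarrow> level e 0 x = limit_level x"
  using limit_level_eq[of d x] level_stable[of d 0 x e] by simp

lemma measurable_level [measurable]: "level d m \<in> borel \<rightarrow>\<^sub>M count_space UNIV"
proof (induction d arbitrary: m)
  case 0
  have "level 0 m = (\<lambda>x. m)" by auto
  then show ?case by simp
next
  case (Suc d)
  note [measurable] = Suc.IH
  have "level (Suc d) m = (\<lambda>x. if x < gap m then m
     else if x < mid m then level d (Suc m) (x - gap m) else level d (Suc m) (x - mid m))"
    by auto
  then show ?case by simp
qed

lemma measurable_limit_level [measurable]: "limit_level \<in> borel \<rightarrow>\<^sub>M count_space UNIV"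
  unfolding limit_level_def by measurable

text \<open>
  The total length of the undivided cells.
\<close>
lemma primitive_deepest: "primitive (\<lambda>k. if k = m + d then 1 else 0) d m (len m) = 2 ^ d * len (m + d)"
proof (induction d arbitrary: m)
  case (Suc d)
  then show ?case using tree_order[of m] len_minus_mid[of m] Suc.IH[of "Suc m"] by simp
qed simp

text \<open>
  After \<open>d\<close> generations the undivided cells have total measure \<open>1 / height d\<close>, which tends to \<open>0\<close>.
\<close>
lemma AE_level_less: "AE x in lebesgue. x \<in> {0..1} \<longrightarrow> (\<exists>d. level d 0 x < d)"
proof -
  define S where "S d = {x \<in> {0..1}. level d 0 x = d}" for d
  have lm: "S d \<in> lmeasurable" for d
  proof (rule bounded_set_imp_lmeasurable)
    show "bounded (S d)" by (rule bounded_subset[OF bounded_closed_interval[of 0 1]]) (auto simp: S_def)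
    have "S d \<in> sets borel" unfolding S_def by measurable
    then show "S d \<in> sets lebesgue" by simp
  qed
  have meas: "measure lebesgue (S d) = 1 / height d" for d
  proof -
    have "((\<lambda>x. if level d 0 x = d then 1 else 0) has_integral 2 ^ d * len d) {0..1::real}"
      using has_integral_level[of 0 1 "\<lambda>k. if k = 0 + d then 1 else 0" d 0] primitive_deepest[of 0 d] by simp
    then have "((\<lambda>x. if x \<in> {0..1::real} then if level d 0 x = d then 1 else 0 else 0) has_integral 2 ^ d * len d) UNIV"
      by (simp only: has_integral_restrict_UNIV)
    moreover have "(\<lambda>x. if x \<in> {0..1::real} then if level d 0 x = d then 1 else 0 else 0) = indicat_real (S d)"
      by (auto simp: S_def indicator_def)
    ultimately have "(indicat_real (S d) has_integral 2 ^ d * len d) UNIV" by simp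
    moreover have "(indicat_real (S d) has_integral measure lebesgue (S d)) UNIV"
      using lm[of d] by (simp add: lmeasurable_iff_has_integral)
    ultimately have "measure lebesgue (S d) = 2 ^ d * len d" by (rule has_integral_unique[symmetric])
    then show ?thesis by (simp add: len_def)
  qed
  define N where "N = (\<Inter>d. S d)"
  have N: "N \<in> sets lebesgue" unfolding N_def using lm by (intro sets.countable_INT) auto
  have le: "measure lebesgue N \<le> 1 / height d" for d
    using measure_mono_fmeasurable[OF _ N lm[of d]] meas[of d] by (auto simp: N_def)
  have "measure lebesgue N = 0"
  proof (rule ccontr)
    assume "measure lebesgue N \<noteq> 0"
    then have pos: "0 < measure lebesgue N" by (simp add: order_less_le)
    obtain d where "1 / measure lebesgue N < height d" using height_unbounded by blast
    then have "1 / height d < measure lebesgue N" using pos height_pos[of d] by (simp add: field_simps)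
    with le[of d] show False by simp
  qed
  moreover have "N \<in> lmeasurable"
    by (rule fmeasurableI2[OF lm[of 0] _ N]) (auto simp: N_def)
  ultimately have "N \<in> null_sets lebesgue" by (simp add: emeasure_eq_measure2 null_setsI)
  then have "AE x in lebesgue. x \<notin> N" by (rule AE_not_in)
  then show ?thesis
  proof eventually_elim
    case (elim x)
    show ?case
    proof
      assume "x \<in> {0..1}"
      with elim obtain d where "level d 0 x \<noteq> d" by (auto simp: N_def S_def)
      then show "\<exists>d. level d 0 x < d" using level_le[of d 0 x] by (intro exI[of _ d]) simp
    qed
  qed
qed

end

context gap_tree_exponent
begin

abbreviation trunc :: "nat \<Rightarrow> real \<Rightarrow> real" where
  "trunc d x \<equiv> val (level d 0 x)"

abbreviation profile :: "real \<Rightarrow> real" where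
  "profile x \<equiv> val (limit_level x)"

lemma trunc_integrable: "set_integrable lebesgue {0..1} (trunc d)"
proof (rule set_integrable_bound)
  show "set_integrable lebesgue {0..1::real} (\<lambda>x. val d)"
    by (auto simp: set_integrable_def intro!: integrable_real_indicator)
  have "trunc d \<in> borel_measurable borel" by measurable
  then have "(\<lambda>x. indicator {0..1} x *\<^sub>R trunc d x) \<in> borel_measurable borel" by measurable
  then show "set_borel_measurable lebesgue {0..1} (trunc d)"
    unfolding set_borel_measurable_def by (simp add: measurable_completion)
  show "AE x in lebesgue. x \<in> {0..1} \<longrightarrow> norm (trunc d x) \<le> norm (val d)"
    using val_pos val_mono level_le[of d 0] by (auto simp: less_imp_le)
qed

lemma avg_trunc:
  assumes "0 \<le> u" "u < v" "v \<le> 1"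
  shows "avg {u..<v} (trunc d) = (primitive val d 0 v - primitive val d 0 u) / (v - u)"
proof -
  have "set_integrable lebesgue {u..v} (trunc d)"
    using trunc_integrable by (rule set_integrable_subset) (use assms in auto)
  then have "(LINT x:{u..v}|lebesgue. trunc d x) = integral {u..v} (trunc d)"
    by (rule set_lebesgue_integral_eq_integral(2))
  also have "\<dots> = primitive val d 0 v - primitive val d 0 u"
    using has_integral_level[of u v val d 0] assms by (intro integral_unique) simp
  finally show ?thesis
    using avg_sandwich(1)[OF greaterThanLessThan_subseteq_atLeastAtMost_iff[THEN iffD2] order_refl, of u v "trunc d"] assms
    by (simp add: avg_def)
qed

lemma AE_trunc_mono_tendsto:
  "AE x in lebesgue. x \<in> {0..1} \<longrightarrow> mono (\<lambda>d. trunc d x) \<and> (\<lambda>d. trunc d x) \<longlonglongrightarrow> profile x \<and> (\<forall>d. trunc d x \<le> profile x)"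
  using AE_level_less
proof eventually_elim
  case (elim x)
  show ?case
  proof
    assume "x \<in> {0..1}"
    with elim obtain d where d: "level d 0 x < d" by blast
    have mono: "mono (\<lambda>d. trunc d x)" by (intro monoI val_mono level_mono)
    have ev: "trunc e x = profile x" if "d \<le> e" for e
      using limit_level_eq_later[OF d that] by simp
    have "(\<lambda>d. trunc d x) \<longlonglongrightarrow> profile x"
      by (rule tendsto_eventually) (auto simp: eventually_sequentially intro!: exI[of _ d] ev)
    moreover have "trunc e x \<le> profile x" for e
      using monoD[OF mono, of e "max d e"] ev[of "max d e"] by simp
    ultimately show "mono (\<lambda>d. trunc d x) \<and> (\<lambda>d. trunc d x) \<longlonglongrightarrow> profile x \<and> (\<forall>d. trunc d x \<le> profile x)"
      using mono by blast
  qed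
qed

lemma profile_measurable: "(\<lambda>x. indicator {0..1} x *\<^sub>R profile x) \<in> borel_measurable lebesgue"
proof -
  have "profile \<in> borel_measurable borel" by measurable
  then have "(\<lambda>x. indicator {0..1} x *\<^sub>R profile x) \<in> borel_measurable borel" by measurable
  then show ?thesis by (simp add: measurable_completion)
qed

text \<open>
  Monotone convergence, as all truncations have integral at most \<open>cell_const\<close>.
\<close>
lemma profile_integrable: "set_integrable lebesgue {0..1} profile"
proof -
  define I where "I d = (LINT x:{0..1}|lebesgue. trunc d x)" for d
  have I: "I d = primitive val d 0 1" for d
  proof -
    have "I d = integral {0..1} (trunc d)"
      unfolding I_def by (rule set_lebesgue_integral_eq_integral(2)[OF trunc_integrable])
    also have "\<dots> = primitive val d 0 1"
      using has_integral_level[of 0 1 val d 0] by (intro integral_unique) simp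
    finally show ?thesis .
  qed
  have "incseq I"
    unfolding I_def
  proof (rule incseq_SucI)
    show "(LINT x:{0..1}|lebesgue. trunc d x) \<le> (LINT x:{0..1}|lebesgue. trunc (Suc d) x)" for d
      by (rule set_integral_mono[OF trunc_integrable trunc_integrable]) (intro val_mono level_mono, simp)
  qed
  moreover have "I d \<le> cell_const" for d
    using primitive_cell_le[of d 0] by (simp add: I val_def)
  ultimately obtain y where y: "I \<longlonglongrightarrow> y" using incseq_convergent by metis
  show ?thesis unfolding set_integrable_def
  proof (rule integrable_monotone_convergence)
    show "integrable lebesgue (\<lambda>x. indicator {0..1} x *\<^sub>R trunc d x)" for d
      using trunc_integrable[of d] by (simp add: set_integrable_def)
    show "AE x in lebesgue. mono (\<lambda>d. indicator {0..1} x *\<^sub>R trunc d x)"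
      using AE_trunc_mono_tendsto by eventually_elim (auto simp: mono_def indicator_def)
    show "AE x in lebesgue. (\<lambda>d. indicator {0..1} x *\<^sub>R trunc d x) \<longlonglongrightarrow> indicator {0..1} x *\<^sub>R profile x"
      using AE_trunc_mono_tendsto by eventually_elim (auto simp: indicator_def)
    show "(\<lambda>d. LINT x|lebesgue. indicator {0..1} x *\<^sub>R trunc d x) \<longlonglongrightarrow> y"
      using y by (simp add: I_def[abs_def] set_lebesgue_integral_def)
  qed (rule profile_measurable)
qed

lemma avg_trunc_tendsto:
  assumes "0 \<le> u" "u < v" "v \<le> 1"
  shows "(\<lambda>d. avg {u..<v} (trunc d)) \<longlonglongrightarrow> avg {u..<v} profile"
proof -
  have sub: "{u..<v} \<subseteq> {0..1}" using assms by auto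
  have P: "set_integrable lebesgue {u..<v} profile"
    using profile_integrable by (rule set_integrable_subset) (use sub in auto)
  have T: "set_integrable lebesgue {u..<v} (trunc d)" for d
    using trunc_integrable by (rule set_integrable_subset) (use sub in auto)
  have "(\<lambda>d. LINT x|lebesgue. indicator {u..<v} x *\<^sub>R trunc d x) \<longlonglongrightarrow> (LINT x|lebesgue. indicator {u..<v} x *\<^sub>R profile x)"
  proof (rule integral_dominated_convergence)
    show "(\<lambda>x. indicator {u..<v} x *\<^sub>R profile x) \<in> borel_measurable lebesgue"
      "integrable lebesgue (\<lambda>x. indicator {u..<v} x *\<^sub>R profile x)"
      using P by (auto simp: set_integrable_def)
    show "(\<lambda>x. indicator {u..<v} x *\<^sub>R trunc d x) \<in> borel_measurable lebesgue" for d
      using T[of d] by (auto simp: set_integrable_def)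
    show "AE x in lebesgue. (\<lambda>d. indicator {u..<v} x *\<^sub>R trunc d x) \<longlonglongrightarrow> indicator {u..<v} x *\<^sub>R profile x"
      using AE_trunc_mono_tendsto by eventually_elim (use sub in \<open>auto simp: indicator_def\<close>)
    show "AE x in lebesgue. norm (indicator {u..<v} x *\<^sub>R trunc d x) \<le> indicator {u..<v} x *\<^sub>R profile x" for d
      using AE_trunc_mono_tendsto
    proof eventually_elim
      case (elim x)
      then show ?case using sub val_pos[of "level d 0 x"] by (cases "x \<in> {u..<v}") (auto simp: subset_iff)
    qed
  qed
  then show ?thesis unfolding avg_def set_lebesgue_integral_def by (intro tendsto_mult_left)
qed

text \<open>
  The lower bound \<open>b\<close> that \<open>oscillation_le_charge\<close> gives for the truncation is also one for the profile, so the
  deviation of the profile is at most \<open>2 * (avg - b)\<close>; the difference between the averages of the profile and of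
  its truncation appears as an error term that vanishes in the limit.
\<close>
lemma deviation_le_charge:
  assumes uv: "0 \<le> u" "u < v" "v \<le> 1"
  shows "(v - u) * (avg {u..<v} (\<lambda>x. \<bar>profile x - avg {u..<v} profile\<bar>)) powr q
    \<le> 4 powr q * ((v - u) * \<bar>avg {u..<v} profile - avg {u..<v} (trunc d)\<bar> powr q
        + energy_const * (charge d 0 v - charge d 0 u))"
proof -
  define a where "a = avg {u..<v} profile"
  define a' where "a' = avg {u..<v} (trunc d)"
  define D where "D = avg {u..<v} (\<lambda>x. \<bar>profile x - a\<bar>)"
  define \<eta> where "\<eta> = \<bar>a - a'\<bar>"
  have sub: "{u..<v} \<subseteq> {0..1}" using uv by auto
  have P: "set_integrable lebesgue {u..<v} profile"
    using profile_integrable by (rule set_integrable_subset) (use sub in auto)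
  have T: "set_integrable lebesgue {u..<v} (trunc d)"
    using trunc_integrable by (rule set_integrable_subset) (use sub in auto)
  obtain b where b: "\<And>x. u \<le> x \<Longrightarrow> x < v \<Longrightarrow> b \<le> trunc d x"
    and E: "(v - u) * ((primitive val d 0 v - primitive val d 0 u - b * (v - u)) / (v - u)) powr q
      \<le> energy_const * (charge d 0 v - charge d 0 u)"
    using oscillation_le_charge[of u v 0 d] uv by auto
  have bT: "AE x\<in>{u..<v} in lebesgue. b \<le> trunc d x" using b by simp
  have bP: "AE x\<in>{u..<v} in lebesgue. b \<le> profile x"
    using AE_trunc_mono_tendsto
  proof eventually_elim
    case (elim x)
    show ?case
    proof
      assume x: "x \<in> {u..<v}"
      then have "trunc d x \<le> profile x" using elim sub by blast
      moreover have "b \<le> trunc d x" using b x by simp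
      ultimately show "b \<le> profile x" by (rule order_trans[rotated])
    qed
  qed
  define x where "x = a' - b"
  have x: "0 \<le> x" using avg_deviation_le(1)[OF T uv(2) bT] by (simp add: x_def a'_def)
  have xE: "(v - u) * x powr q \<le> energy_const * (charge d 0 v - charge d 0 u)"
  proof -
    have "x = (primitive val d 0 v - primitive val d 0 u - b * (v - u)) / (v - u)"
      unfolding x_def a'_def avg_trunc[OF uv] using uv by (simp add: diff_divide_distrib)
    then show ?thesis using E by simp
  qed
  have D: "0 \<le> D" unfolding D_def avg_def set_lebesgue_integral_def
    by (intro mult_nonneg_nonneg integral_nonneg) auto
  have "D \<le> 2 * (a - b)"
    using avg_deviation_le(2)[OF P uv(2) bP] by (simp add: D_def a_def)
  also have "a - b \<le> \<eta> + x" by (simp add: x_def \<eta>_def)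
  also have "2 * (\<eta> + x) \<le> 4 * max \<eta> x" by simp
  finally have "D powr q \<le> (4 * max \<eta> x) powr q" using D q_gt_1 by (intro powr_mono2) auto
  also have "\<dots> = 4 powr q * max \<eta> x powr q" by (rule powr_mult)
  also have "\<dots> \<le> 4 powr q * (\<eta> powr q + x powr q)" by (intro mult_left_mono) (auto simp: max_def)
  finally have "(v - u) * D powr q \<le> (v - u) * (4 powr q * (\<eta> powr q + x powr q))"
    using uv by (intro mult_left_mono) auto
  also have "\<dots> = 4 powr q * ((v - u) * \<eta> powr q + (v - u) * x powr q)" by (simp add: algebra_simps)
  also have "\<dots> \<le> 4 powr q * ((v - u) * \<eta> powr q + energy_const * (charge d 0 v - charge d 0 u))"
    using xE by (intro mult_left_mono) auto
  finally show ?thesis by (simp only: D_def \<eta>_def a_def a'_def)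
qed

text \<open>
  For a fixed finite family, add up the bounds at truncation depth \<open>d\<close>. The increments of the charge sum to at most
  its total, which is bounded uniformly in \<open>d\<close>; then let \<open>d\<close> tend to infinity to remove the truncation errors.
\<close>
theorem profile_in_JN:
  assumes "summable (\<lambda>m. \<epsilon> m powr (q + 1))"
  shows "profile \<in> JN q {0..1}"
proof -
  define B where "B = 4 powr q * (energy_const * (1 + 8 powr q * (\<Sum>m. \<epsilon> m powr (q + 1))))"
  show ?thesis
  proof (rule JN_unit_interval_I[where B = B])
    fix n :: nat and u v :: "nat \<Rightarrow> real"
    assume uv: "\<And>i. i < n \<Longrightarrow> 0 \<le> u i \<and> u i \<le> v i \<and> v i \<le> 1"
      and disj: "\<And>i j. i < n \<Longrightarrow> j < n \<Longrightarrow> i \<noteq> j \<Longrightarrow> {u i<..<v i} \<inter> {u j<..<v j} = {}"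
    define e where "e i = (v i - u i) * (avg {u i..<v i} (\<lambda>x. \<bar>profile x - avg {u i..<v i} profile\<bar>)) powr q" for i
    define r where "r d i = (v i - u i) * \<bar>avg {u i..<v i} profile - avg {u i..<v i} (trunc d)\<bar> powr q" for d i
    have "e i \<le> 4 powr q * (r d i + energy_const * (charge d 0 (v i) - charge d 0 (u i)))" if "i < n" for d i
      using deviation_le_charge[of "u i" "v i" d] uv[OF that] unfolding e_def r_def by (cases "u i = v i") auto
    then have "(\<Sum>i<n. e i) \<le> (\<Sum>i<n. 4 powr q * (r d i + energy_const * (charge d 0 (v i) - charge d 0 (u i))))" for d
      by (intro sum_mono) auto
    also have "(\<Sum>i<n. 4 powr q * (r d i + energy_const * (charge d 0 (v i) - charge d 0 (u i))))
      = 4 powr q * (\<Sum>i<n. r d i) + 4 powr q * (energy_const * (\<Sum>i<n. charge d 0 (v i) - charge d 0 (u i)))" for d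
      by (simp add: sum_distrib_left[symmetric] sum.distrib distrib_left)
    also have "\<dots> d \<le> 4 powr q * (\<Sum>i<n. r d i) + B" for d
    proof -
      have "(\<Sum>i<n. charge d 0 (v i) - charge d 0 (u i)) \<le> charge d 0 1 - charge d 0 0"
        using charge_mono uv disj by (intro sum_increments_le[where a = 0 and b = 1]) auto
      also have "\<dots> \<le> 1 + 8 powr q * (\<Sum>j<d. \<epsilon> j powr (q + 1))"
        using charge_root_le[of d 0] by simp
      also have "\<dots> \<le> 1 + 8 powr q * (\<Sum>m. \<epsilon> m powr (q + 1))"
        using sum_le_suminf[OF assms, of "{..<d}"] by (intro add_left_mono mult_left_mono) auto
      finally show ?thesis unfolding B_def
        by (intro add_left_mono mult_left_mono) (auto simp: energy_const_def)
    qed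
    finally have bound: "(\<Sum>i<n. e i) \<le> 4 powr q * (\<Sum>i<n. r d i) + B" for d .
    have "(\<lambda>d. r d i) \<longlonglongrightarrow> 0" if "i < n" for i
    proof (cases "u i = v i")
      case False
      then have "(\<lambda>d. avg {u i..<v i} (trunc d)) \<longlonglongrightarrow> avg {u i..<v i} profile"
        using uv[OF that] by (intro avg_trunc_tendsto) auto
      then have "(\<lambda>d. \<bar>avg {u i..<v i} profile - avg {u i..<v i} (trunc d)\<bar>) \<longlonglongrightarrow> 0"
        by (intro tendsto_rabs_zero) (auto intro: tendsto_eq_intros)
      then have "(\<lambda>d. \<bar>avg {u i..<v i} profile - avg {u i..<v i} (trunc d)\<bar> powr q) \<longlonglongrightarrow> 0"
        using q_gt_1 by (intro tendsto_zero_powrI[OF _ tendsto_const]) auto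
      from tendsto_mult_left[OF this, of "v i - u i"] show ?thesis by (simp add: r_def)
    qed (simp add: r_def)
    then have "(\<lambda>d. \<Sum>i<n. r d i) \<longlonglongrightarrow> 0"
      using tendsto_sum[of "{..<n}" "\<lambda>i d. r d i" "\<lambda>i. 0"] by simp
    from tendsto_add[OF tendsto_mult_left[OF this, of "4 powr q"] tendsto_const[of B]]
    have "(\<lambda>d. 4 powr q * (\<Sum>i<n. r d i) + B) \<longlonglongrightarrow> B" by simp
    then show "(\<Sum>i<n. (v i - u i) * (avg {u i..<v i} (\<lambda>x. \<bar>profile x - avg {u i..<v i} profile\<bar>)) powr q) \<le> B"
      unfolding e_def[symmetric] by (rule LIMSEQ_le_const) (use bound in auto)
  qed (use q_gt_1 profile_integrable in auto)
qed

end

section \<open>Short intervals around the ends of gaps\<close>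

context gap_tree
begin

text \<open>
  The ends of the gaps inside a cell, from left to right, each with the level of its gap.
\<close>
primrec junctions :: "nat \<Rightarrow> nat \<Rightarrow> (nat \<times> real) list" where
  "junctions 0 m = []"
| "junctions (Suc d) m = (m, gap m) #
    map (\<lambda>(j, y). (j, gap m + y)) (junctions d (Suc m)) @
    map (\<lambda>(j, y). (j, mid m + y)) (junctions d (Suc m))"

lemma junctions_cases [consumes 1, case_names top left right]:
  assumes "(j, y) \<in> set (junctions (Suc d) m)"
  obtains "j = m" "y = gap m"
  | z where "y = gap m + z" "(j, z) \<in> set (junctions d (Suc m))"
  | z where "y = mid m + z" "(j, z) \<in> set (junctions d (Suc m))"
  using assms by auto

lemma junctions_range:
  "(j, y) \<in> set (junctions d m) \<Longrightarrow>
    j < m + d \<and> gap m / 2 \<le> y - gap (Suc j) / 2 \<and> y + gap (Suc j) / 2 \<le> len m"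
proof (induction d arbitrary: m y)
  case (Suc d)
  note o = tree_order[of m] mid_minus_gap[of m] len_minus_mid[of m] gap_pos[of "Suc m"]
    gap_Suc_le[of m] gap_le_len_Suc[of m]
  from Suc.prems show ?case
  proof (cases rule: junctions_cases)
    case top
    then show ?thesis using o by simp
  next
    case (left z)
    then show ?thesis using Suc.IH[OF left(2)] o by simp
  next
    case (right z)
    then show ?thesis using Suc.IH[OF right(2)] o by simp
  qed
qed simp

text \<open>
  Left of a gap's end there is this gap, and right of it there is the first child cell, which begins with its own gap.
\<close>
lemma junctions_level:
  assumes "(j, y) \<in> set (junctions d m)"
  shows "y - gap (Suc j) / 2 \<le> x \<Longrightarrow> x < y \<Longrightarrow> level (Suc d) m x = j"
    and "y \<le> x \<Longrightarrow> x < y + gap (Suc j) / 2 \<Longrightarrow> level (Suc d) m x = Suc j"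
proof -
  have "(y - gap (Suc j) / 2 \<le> x \<and> x < y \<longrightarrow> level (Suc d) m x = j) \<and>
      (y \<le> x \<and> x < y + gap (Suc j) / 2 \<longrightarrow> level (Suc d) m x = Suc j)"
    using assms
  proof (induction d arbitrary: m y x)
    case (Suc d)
    note o = tree_order[of m] mid_minus_gap[of m] len_minus_mid[of m] gap_pos[of "Suc m"]
      gap_Suc_le[of m] gap_le_len_Suc[of m] gap_pos[of "Suc j"]
    have top_level: "level (Suc (Suc d)) m x = (if x < gap m then m
      else if x < mid m then level (Suc d) (Suc m) (x - gap m) else level (Suc d) (Suc m) (x - mid m))" for x
      by simp
    from Suc.prems show ?case
    proof (cases rule: junctions_cases)
      case top
      then show ?thesis using o by simp
    next
      case (left z)
      have "gap m \<le> x \<and> x < mid m" if "y - gap (Suc j) / 2 \<le> x" "x < y + gap (Suc j) / 2"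
        using that left(1) junctions_range[OF left(2)] o by linarith
      then show ?thesis
        using Suc.IH[OF left(2), of "x - gap m"] left(1) o unfolding top_level by auto
    next
      case (right z)
      have "mid m \<le> x" if "y - gap (Suc j) / 2 \<le> x"
        using that right(1) junctions_range[OF right(2)] o by linarith
      then show ?thesis
        using Suc.IH[OF right(2), of "x - mid m"] right(1) o unfolding top_level by auto
    qed
  qed simp
  then show "y - gap (Suc j) / 2 \<le> x \<Longrightarrow> x < y \<Longrightarrow> level (Suc d) m x = j"
    and "y \<le> x \<Longrightarrow> x < y + gap (Suc j) / 2 \<Longrightarrow> level (Suc d) m x = Suc j" by blast+
qed

text \<open>
  An interval around a junction reaches only half way into the gap that begins there, and the next junction
  does not come before the end of that gap. The same margin, half a gap at the start of every cell, is what \<open>junctions_range\<close> provides.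
\<close>
lemma junctions_sorted:
  "sorted_wrt (\<lambda>(j, y) (k, z). y + gap (Suc j) / 2 \<le> z - gap (Suc k) / 2) (junctions d m)"
proof (induction d arbitrary: m)
  case (Suc d)
  note o = tree_order[of m] mid_minus_gap[of m] gap_pos[of "Suc m"]
  have r: "gap (Suc m) / 2 \<le> y - gap (Suc j) / 2" "y + gap (Suc j) / 2 \<le> len (Suc m)"
    if "(j, y) \<in> set (junctions d (Suc m))" for j y
    using junctions_range[OF that] by auto
  have *: "gap m + y + gap (Suc j) / 2 \<le> mid m + z - gap (Suc k) / 2"
    "gap m + gap (Suc m) / 2 \<le> gap m + y - gap (Suc j) / 2"
    "gap m + gap (Suc m) / 2 \<le> mid m + y - gap (Suc j) / 2"
    if "(j, y) \<in> set (junctions d (Suc m))" "(k, z) \<in> set (junctions d (Suc m))" for j y k z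
    using r[OF that(1)] r[OF that(2)] o by linarith+
  have shift: "sorted_wrt (\<lambda>(j, y) (k, z). y + gap (Suc j) / 2 \<le> z - gap (Suc k) / 2)
      (map (\<lambda>(j, y). (j, t + y)) (junctions d (Suc m)))" for t
    unfolding sorted_wrt_map using Suc.IH[of "Suc m"]
    by (rule sorted_wrt_mono_rel[rotated]) auto
  show ?case using * shift by (auto simp: sorted_wrt_append)
qed simp

lemma sum_list_junctions:
  "(\<Sum>(j, y)\<leftarrow>junctions d m. w j) = (\<Sum>i<d. 2 ^ i * w (m + i))" for w :: "nat \<Rightarrow> real"
proof (induction d arbitrary: m)
  case (Suc d)
  have "(\<Sum>(j, y)\<leftarrow>junctions (Suc d) m. w j) = w m + 2 * (\<Sum>(j, y)\<leftarrow>junctions d (Suc m). w j)"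
    by (simp add: comp_def case_prod_unfold)
  then show ?case
    unfolding Suc.IH by (simp add: sum.lessThan_Suc_shift sum_distrib_left mult_ac del: sum.lessThan_Suc)
qed simp

end

context gap_tree_exponent
begin

text \<open>
  The tangent inequality at \<open>1 / (1 + \<epsilon> m)\<close> gives \<open>(1 + \<epsilon> m) powr (1 / q) \<ge> 1 / (1 - s) \<ge> 1 + s\<close> with
  \<open>s = \<epsilon> m / (q * (1 + \<epsilon> m))\<close>.
\<close>
lemma val_jump_ge: "\<epsilon> m / (2 * q) * val m \<le> val (Suc m) - val m"
proof -
  define r where "r = 1 + \<epsilon> m"
  define s where "s = \<epsilon> m / (q * r)"
  have r: "1 < r" "r \<le> 2" using eps_pos[of m] eps_le_half[of m] by (simp_all add: r_def)
  have s: "0 < s" using eps_pos[of m] r q_gt_1 by (simp add: s_def)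
  have "(1 / r) powr (1 / q) \<le> 1 + 1 / q * (1 / r - 1)"
    using r q_gt_1 by (intro powr_le_tangent_at_1) auto
  also have "1 / r - 1 = - \<epsilon> m / r" using r by (simp add: r_def field_simps)
  finally have "(1 / r) powr (1 / q) \<le> 1 - s" by (simp add: s_def)
  then have "r powr (1 / q) * (1 / r) powr (1 / q) \<le> r powr (1 / q) * (1 - s)"
    by (intro mult_left_mono) auto
  moreover have "r powr (1 / q) * (1 / r) powr (1 / q) = 1" using r by (simp flip: powr_mult)
  ultimately have one: "1 \<le> r powr (1 / q) * (1 - s)" by simp
  then have "s < 1" using r by (smt (verit) mult_nonneg_nonpos powr_ge_zero)
  have "1 + s \<le> r powr (1 / q)"
  proof (rule ccontr)
    assume "\<not> ?thesis"
    then have "r powr (1 / q) * (1 - s) \<le> (1 + s) * (1 - s)" using \<open>s < 1\<close> by (intro mult_right_mono) auto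
    also have "\<dots> < 1" using s by (simp add: algebra_simps)
    finally show False using one by simp
  qed
  moreover have "\<epsilon> m / (2 * q) \<le> s"
    unfolding s_def using r q_gt_1 eps_pos[of m] by (intro divide_left_mono) auto
  ultimately have "\<epsilon> m / (2 * q) \<le> r powr (1 / q) - 1" by simp
  from mult_right_mono[OF this, of "val m"] show ?thesis
    using val_pos[of m] by (simp add: val_Suc r_def algebra_simps)
qed

text \<open>
  There are \<open>2 ^ m\<close> junctions of level \<open>m\<close>; on the interval around each of them, of length \<open>gap (Suc m)\<close>, the
  profile takes two values equally often.
\<close>
lemma junction_energy_ge:
  "(1 / (4 * q)) powr q / 8 * \<epsilon> (Suc m) powr (q + 1) \<le> 2 ^ m * (gap (Suc m) * ((val (Suc m) - val m) / 2) powr q)"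
proof -
  define c where "c = (1 / (4 * q)) powr q"
  have e: "0 < \<epsilon> m" "0 < \<epsilon> (Suc m)" "\<epsilon> (Suc m) \<le> \<epsilon> m" using eps_pos eps_Suc_le by auto
  have "\<epsilon> m / (4 * q) * val m \<le> (val (Suc m) - val m) / 2" using val_jump_ge[of m] by simp
  then have "(\<epsilon> m / (4 * q) * val m) powr q \<le> ((val (Suc m) - val m) / 2) powr q"
    using e q_gt_1 val_pos[of m] by (intro powr_mono2) auto
  moreover have "(\<epsilon> m / (4 * q) * val m) powr q = c * \<epsilon> m powr q * height m"
    using e q_gt_1 val_pos[of m] by (simp add: c_def powr_mult powr_divide val_powr)
  moreover have "c * \<epsilon> (Suc m) powr q * height m \<le> c * \<epsilon> m powr q * height m"
    using e q_gt_1 height_pos[of m] by (intro mult_right_mono mult_left_mono powr_mono2) (auto simp: c_def)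
  ultimately have jump: "c * \<epsilon> (Suc m) powr q * height m \<le> ((val (Suc m) - val m) / 2) powr q" by linarith
  have "height (Suc (Suc m)) \<le> (3 / 2) * ((3 / 2) * height m)"
    unfolding height_Suc using eps_le_half height_pos[of m] eps_pos
    by (intro mult_mono) (auto simp: less_imp_le add_increasing)
  then have h: "height (Suc (Suc m)) \<le> 4 * height m" using height_pos[of m] by simp
  have "\<epsilon> (Suc m) / (8 * height m) \<le> \<epsilon> (Suc m) / (2 * height (Suc (Suc m)))"
    using h e height_pos by (intro divide_left_mono) auto
  also have "\<dots> = 2 ^ m * gap (Suc m)" by (simp add: gap_def len_def)
  finally have "\<epsilon> (Suc m) / (8 * height m) * (c * \<epsilon> (Suc m) powr q * height m)
    \<le> 2 ^ m * gap (Suc m) * ((val (Suc m) - val m) / 2) powr q"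
    using jump e height_pos[of m] gap_pos[of "Suc m"] by (intro mult_mono) (auto simp: c_def)
  moreover have "\<epsilon> (Suc m) / (8 * height m) * (c * \<epsilon> (Suc m) powr q * height m) = c / 8 * \<epsilon> (Suc m) powr (q + 1)"
    using e height_pos[of m] by (simp add: powr_add)
  ultimately show ?thesis by (simp add: c_def mult_ac)
qed

text \<open>
  The intervals around the junctions of the first \<open>d\<close> levels form a disjoint family, and the bound on its sum does
  not depend on \<open>d\<close>.
\<close>
theorem summable_if_profile_in_JN:
  assumes "profile \<in> JN q {0..1}"
  shows "summable (\<lambda>m. \<epsilon> m powr (q + 1))"
proof -
  obtain K where K: "\<And>Q :: nat \<Rightarrow> real set. (\<And>i. is_interval (Q i)) \<Longrightarrow> (\<And>i. Q i \<subseteq> {0..1}) \<Longrightarrow> disjoint_family Q \<Longrightarrow>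
      (\<Sum>i. ennreal (measure lebesgue (Q i) * (avg (Q i) (\<lambda>x. \<bar>profile x - avg (Q i) profile\<bar>)) powr q))
      \<le> ennreal (K powr q)"
    using assms unfolding JN_def by blast
  define w where "w j = gap (Suc j) * ((val (Suc j) - val j) / 2) powr q" for j
  have w: "0 \<le> w j" for j using gap_pos[of "Suc j"] by (simp add: w_def)
  have bound: "(\<Sum>i<d. 2 ^ i * w i) \<le> K powr q" for d
  proof -
    define xs where "xs = junctions d 0"
    define I where "I p = {snd p - gap (Suc (fst p)) / 2..<snd p + gap (Suc (fst p)) / 2}" for p :: "nat \<times> real"
    define Q where "Q i = (if i < length xs then I (xs ! i) else {})" for i
    have mem: "(fst (xs ! i), snd (xs ! i)) \<in> set (junctions d 0)" if "i < length xs" for i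
      using that by (simp add: xs_def)
    have "disjoint_family Q"
    proof -
      have "Q i \<inter> Q k = {}" if "i < k" for i k
      proof (cases "k < length xs")
        case True
        have "snd (xs ! i) + gap (Suc (fst (xs ! i))) / 2 \<le> snd (xs ! k) - gap (Suc (fst (xs ! k))) / 2"
          using sorted_wrt_nth_less[OF junctions_sorted[of d 0], of i k] that True
          by (simp add: xs_def case_prod_unfold)
        then show ?thesis using that True by (auto simp: Q_def I_def)
      qed (simp add: Q_def)
      then show ?thesis unfolding disjoint_family_on_def by (metis Int_commute linorder_neqE_nat)
    qed
    moreover have "Q i \<subseteq> {0..1}" for i
      using junctions_range[OF mem[of i]] gap_pos[of 0] by (auto simp: Q_def I_def)
    moreover have "is_interval (Q i)" for i
      by (auto simp: Q_def I_def is_interval_1)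
    ultimately have total: "(\<Sum>i. ennreal (measure lebesgue (Q i) * (avg (Q i) (\<lambda>x. \<bar>profile x - avg (Q i) profile\<bar>)) powr q))
      \<le> ennreal (K powr q)" by (intro K)
    have terms: "measure lebesgue (Q i) * (avg (Q i) (\<lambda>x. \<bar>profile x - avg (Q i) profile\<bar>)) powr q = w (fst (xs ! i))"
      if i: "i < length xs" for i
    proof -
      obtain j y where jy: "xs ! i = (j, y)" by fastforce
      have m: "(j, y) \<in> set (junctions d 0)" using mem[OF i] jy by simp
      define r where "r = gap (Suc j) / 2"
      have r: "0 < r" using gap_pos[of "Suc j"] by (simp add: r_def)
      have j: "Suc j < Suc d" using junctions_range[OF m] by simp
      have left: "profile x = val j" if "y - r \<le> x" "x < y" for x
        using junctions_level(1)[OF m, of x] limit_level_eq[of "Suc d" x] that j by (simp add: r_def del: level.simps)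
      have right: "profile x = val (Suc j)" if "y \<le> x" "x < y + r" for x
        using junctions_level(2)[OF m, of x] limit_level_eq[of "Suc d" x] that j by (simp add: r_def del: level.simps)
      have Qi: "Q i = {y - r..<y + r}" using i jy by (simp add: Q_def I_def r_def)
      have "avg {y - r..<y + r} (\<lambda>x. \<bar>profile x - avg {y - r..<y + r} profile\<bar>) = \<bar>val (Suc j) - val j\<bar> / 2"
        using left right by (intro avg_deviation_two_steps[OF r])
      then show ?thesis
        unfolding Qi using r val_mono[of j "Suc j"] jy by (simp only: w_def) (simp add: r_def)
    qed
    have "(\<Sum>i<length xs. ennreal (w (fst (xs ! i))))
      = (\<Sum>i<length xs. ennreal (measure lebesgue (Q i) * (avg (Q i) (\<lambda>x. \<bar>profile x - avg (Q i) profile\<bar>)) powr q))"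
      by (rule sum.cong) (simp_all only: lessThan_iff terms)
    also have "\<dots> \<le> ennreal (K powr q)"
      using sum_le_suminf[OF summableI finite_lessThan zero_le] total by (rule order_trans)
    finally have "(\<Sum>i<length xs. ennreal (w (fst (xs ! i)))) \<le> ennreal (K powr q)" .
    then have "(\<Sum>i<length xs. w (fst (xs ! i))) \<le> K powr q"
      using w by (simp add: sum_ennreal ennreal_le_iff)
    moreover have "(\<Sum>i<length xs. w (fst (xs ! i))) = (\<Sum>i<d. 2 ^ i * w i)"
      using sum_list_junctions[of w d 0] by (simp add: sum_list_sum_nth xs_def case_prod_unfold atLeast0LessThan)
    ultimately show ?thesis by simp
  qed
  define c where "c = (1 / (4 * q)) powr q / 8"
  have c: "0 < c" using q_gt_1 by (simp add: c_def)
  have "summable (\<lambda>i. c * \<epsilon> (Suc i) powr (q + 1))"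
  proof (rule summableI_nonneg_bounded)
    show "(\<Sum>i<d. c * \<epsilon> (Suc i) powr (q + 1)) \<le> K powr q" for d
      using sum_mono[of "{..<d}" "\<lambda>i. c * \<epsilon> (Suc i) powr (q + 1)" "\<lambda>i. 2 ^ i * w i"]
        junction_energy_ge bound[of d] by (simp add: c_def w_def)
  qed (use c in simp)
  then have "summable (\<lambda>i. \<epsilon> (Suc i) powr (q + 1))" using c by simp
  then show ?thesis by (rule summable_Suc_iff[THEN iffD1])
qed

end

section \<open>The counterexample\<close>

theorem theorem3p1:
  fixes p :: real
  assumes "1 < p"
  shows "\<exists>f :: real \<Rightarrow> real.
    (\<forall>x\<in>{0..1}. 0 \<le> f x) \<and>
    (\<forall>q. 1 < q \<and> q \<le> p \<longrightarrow> (\<lambda>x. f x powr (1 / q)) \<notin> JN q {0..1}) \<and>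
    (\<forall>q. p < q \<longrightarrow> (\<lambda>x. f x powr (1 / q)) \<in> JN q {0..1})"
proof -
  define \<epsilon> :: "nat \<Rightarrow> real" where "\<epsilon> m = 1 / 2 * real (Suc m) powr (- 1 / (p + 1))" for m
  have sum: "summable (\<lambda>m. \<epsilon> m powr s) \<longleftrightarrow> p + 1 < s" if "0 < s" for s
  proof -
    have "\<epsilon> m powr s = (1 / 2) powr s * real (Suc m) powr (- s / (p + 1))" for m
      unfolding \<epsilon>_def powr_mult powr_powr by simp
    then have "summable (\<lambda>m. \<epsilon> m powr s) \<longleftrightarrow> summable (\<lambda>m. real (Suc m) powr (- s / (p + 1)))" by simp
    also have "\<dots> \<longleftrightarrow> - s / (p + 1) < - 1"
      using summable_Suc_iff[of "\<lambda>m. real m powr (- s / (p + 1))"] by (simp add: summable_real_powr_iff)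
    also have "\<dots> \<longleftrightarrow> p + 1 < s" using assms by (simp add: field_simps)
    finally show ?thesis .
  qed
  interpret gap_tree \<epsilon>
  proof
    fix m
    show "0 < \<epsilon> m" by (simp add: \<epsilon>_def)
    have "real (Suc m) powr (- 1 / (p + 1)) \<le> 1 powr (- 1 / (p + 1))"
      using assms by (intro powr_mono2') auto
    then show "\<epsilon> m \<le> 1 / 2" by (simp add: \<epsilon>_def)
    have "real (Suc (Suc m)) powr (- 1 / (p + 1)) \<le> real (Suc m) powr (- 1 / (p + 1))"
      using assms by (intro powr_mono2') auto
    then show "\<epsilon> (Suc m) \<le> \<epsilon> m" by (simp add: \<epsilon>_def)
    have "(\<lambda>m. \<epsilon> m powr 1) = \<epsilon>" by (rule ext) (simp add: \<epsilon>_def)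
    then show "\<not> summable \<epsilon>" using sum[of 1] assms by simp
  qed
  \<comment> \<open>The exponent of \<open>\<epsilon>\<close> makes \<open>p + 1\<close> the threshold for summability of powers, while \<open>JN q\<close> corresponds to the power \<open>q + 1\<close>.\<close>
  have iff: "(\<lambda>x. height (limit_level x) powr (1 / q)) \<in> JN q {0..1} \<longleftrightarrow> p < q" if "1 < q" for q
  proof -
    interpret gap_tree_exponent \<epsilon> q by unfold_locales (rule that)
    have "(\<lambda>x. height (limit_level x) powr (1 / q)) \<in> JN q {0..1} \<longleftrightarrow> summable (\<lambda>m. \<epsilon> m powr (q + 1))"
      using profile_in_JN summable_if_profile_in_JN by (auto simp: val_def)
    then show ?thesis using sum[of "q + 1"] that by simp
  qed
  show ?thesis
  proof (intro exI[of _ "\<lambda>x. height (limit_level x)"] conjI ballI allI impI)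
    show "0 \<le> height (limit_level x)" for x using height_pos by (simp add: less_imp_le)
  qed (use iff assms in auto)
qed

end
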